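(* Let $\mathbb G$, $d$, $\Omega_*$ and $\phi$ be as in the context. Let $g_0=(x_0,t_0)\in\mathbb M$ and let $\theta_0\in\Omega_*$ be the (unique) nondegenerate critical point of $\phi(g_0;\cdot)$ in $\Omega_*$. Then $$d(g_0)^2=\phi(g_0;\theta_0)=\sup_{\tau\in\Omega_*}\phi(g_0;\tau).$$
   Context: Let $q,m\ge1$, $U^{(1)},\dots,U^{(m)}$ linearly independent real skew-symmetric $q\times q$ matrices, $\mathbb G=\mathbb R^q\times\mathbb R^m$ with law $(x,t)\cdot(x',t')=(x+x',t+t'+\frac12\langle\mathbb Ux,x'\rangle)$, $\langle\mathbb Ux,x'\rangle=(\langle U^{(j)}x,x'\rangle)_{j=1}^m$, identity $o=(0,0)$. $d(g)=d(o,g)$ where $d$ is the Carnot–Carathéodory distance: $d(o,g)$ is the infimum of $\int_0^1|x'(s)|ds$ over absolutely continuous curves $(x(s),t(s))$ from $o$ to $g$ with $t'=\frac12\langle\mathbb Ux,x'\rangle$. $U(\tau)=i\sum_j\tau_jU^{(j)}$, $\Omega_*=\{\tau\in\mathbb R^m:\|U(\tau)\|<\pi\}$, $\phi((x,t);\tau)=\langle U(\tau)\cot U(\tau)x,x\rangle+4t\cdot\tau$ for $\tau\in\Omega_*$. $\mathbb M$ is the set of $g\in\mathbb G$ for which there exists $\theta\in\Omega_*$ with $\nabla_\tau\phi(g;\theta)=0$ and $\det\mathrm{Hess}_\tau\phi(g;\theta)\ne0$ (a nondegenerate critical point). *)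

theory Defs
  imports "HOL-Analysis.Analysis"
begin

text \<open>The Lie algebra data: U :: 'm => real^'q^'q, the matrices U^(1..m).
  Points of G are pairs (x,t) :: real^'q * real^'m.\<close>

definition skew_family :: "('m::finite \<Rightarrow> real^'q::finite^'q) \<Rightarrow> bool" where
  "skew_family U \<longleftrightarrow> (\<forall>j. transpose (U j) = - U j) \<and>
     (\<forall>c::'m \<Rightarrow> real. (\<Sum>j\<in>UNIV. c j *\<^sub>R U j) = 0 \<longrightarrow> (\<forall>j. c j = 0))"

text \<open>Horizontal (absolutely continuous) curves from o to (x0,t0), parametrised on [0,1],
  given through their a.e. derivative xd of the horizontal component:
  x(s) = int_0^s xd, t(s) = int_0^s 1/2 <U x, xd>. Their length is int_0^1 |xd|.\<close>

definition horiz_lengths :: "('m::finite \<Rightarrow> real^'q::finite^'q) \<Rightarrow> (real^'q) \<times> (real^'m) \<Rightarrow> real set" where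
  "horiz_lengths U g = {integral {0..1} (\<lambda>s. norm (xd s)) | (xd :: real \<Rightarrow> real^'q) (x :: real \<Rightarrow> real^'q).
      xd absolutely_integrable_on {0..1} \<and>
      (\<forall>s\<in>{0..1}. x s = integral {0..s} xd) \<and>
      x 1 = fst g \<and>
      (\<chi> j. integral {0..1} (\<lambda>s. (1/2) * ((U j *v x s) \<bullet> xd s))) = snd g}"

definition cc_dist :: "('m::finite \<Rightarrow> real^'q::finite^'q) \<Rightarrow> (real^'q) \<times> (real^'m) \<Rightarrow> real" where
  "cc_dist U g = Inf (horiz_lengths U g)"

definition Ucx :: "('m::finite \<Rightarrow> real^'q::finite^'q) \<Rightarrow> real^'m \<Rightarrow> complex^'q^'q" where
  "Ucx U \<tau> = (\<chi> a b. \<i> * complex_of_real (\<Sum>j\<in>UNIV. \<tau> $ j * (U j $ a $ b)))"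

text \<open>Functional calculus for a diagonalisable (here Hermitian) matrix:
  f(M) acts as f(c) on each eigenvector with eigenvalue c.\<close>
definition matfun :: "(complex \<Rightarrow> complex) \<Rightarrow> complex^'n::finite^'n \<Rightarrow> complex^'n^'n" where
  "matfun f M = (THE B. \<forall>v c. M *v v = c *s v \<longrightarrow> B *v v = f c *s v)"

definition zcot :: "complex \<Rightarrow> complex" where
  "zcot z = (if z = 0 then 1 else z * cot z)"

definition Omega_star :: "('m::finite \<Rightarrow> real^'q::finite^'q) \<Rightarrow> (real^'m) set" where
  "Omega_star U = {\<tau>. onorm (\<lambda>v::complex^'q. Ucx U \<tau> *v v) < pi}"

text \<open>phi((x,t);tau) = <U(tau) cot U(tau) x, x> + 4 t.tau (the first term is real).\<close>
definition phi :: "('m::finite \<Rightarrow> real^'q::finite^'q) \<Rightarrow> (real^'q) \<times> (real^'m) \<Rightarrow> real^'m \<Rightarrow> real" where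
  "phi U g \<tau> = Re (\<Sum>a\<in>UNIV. (matfun zcot (Ucx U \<tau>) *v (\<chi> i. complex_of_real (fst g $ i))) $ a
                      * complex_of_real (fst g $ a)) + 4 * (snd g \<bullet> \<tau>)"

definition partial :: "(real^'m::finite \<Rightarrow> real) \<Rightarrow> 'm \<Rightarrow> real^'m \<Rightarrow> real" where
  "partial f j \<tau> = deriv (\<lambda>s. f (\<tau> + s *\<^sub>R axis j 1)) 0"

definition hessian :: "(real^'m::finite \<Rightarrow> real) \<Rightarrow> real^'m \<Rightarrow> real^'m^'m" where
  "hessian f \<tau> = (\<chi> i k. partial (partial f k) i \<tau>)"

definition nondeg_crit :: "('m::finite \<Rightarrow> real^'q::finite^'q) \<Rightarrow> (real^'q) \<times> (real^'m) \<Rightarrow> real^'m \<Rightarrow> bool" where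
  "nondeg_crit U g \<theta> \<longleftrightarrow> \<theta> \<in> Omega_star U \<and> (\<forall>j. partial (phi U g) j \<theta> = 0)
      \<and> det (hessian (phi U g) \<theta>) \<noteq> 0"

definition Mset :: "('m::finite \<Rightarrow> real^'q::finite^'q) \<Rightarrow> ((real^'q) \<times> (real^'m)) set" where
  "Mset U = {g. \<exists>\<theta>. nondeg_crit U g \<theta>}"

end

theory Submission
  imports Defs
begin

text \<open>Write \<open>A = \<Sum>\<^sub>j \<tau>\<^sub>j U\<^sub>j\<close>, a skew operator of norm below \<open>\<pi>\<close>. Then \<open>\<langle>U(\<tau>) cot U(\<tau>) x, x\<rangle>\<close> is the
  least energy \<open>\<integral> |x'|\<^sup>2 - 2 \<langle>A x, x'\<rangle>\<close> of a path from \<open>0\<close> to \<open>x\<close> in unit time. For a horizontal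
  curve ending at \<open>(x, t)\<close> one has \<open>4 t \<bullet> \<tau> = 2 \<integral> \<langle>A x, x'\<rangle>\<close>, so \<open>\<phi>(g; \<tau>)\<close> is at most the squared
  length of every horizontal curve ending at \<open>g\<close>. The lower bound for the energy follows from
  the Riccati equation solved by \<open>m cot (s m)\<close>, used in a discrete form on inscribed polygons.
  The minimiser \<open>z\<close> solves \<open>z' = 2 A z + c\<close> and has constant speed, and by the envelope principle
  \<open>\<partial>\<^sub>j\<phi>(g; \<tau>) = 4 t\<^sub>j - 2 \<integral> \<langle>U\<^sub>j z, z'\<rangle>\<close>. Hence at a critical point the lift of \<open>z\<close> ends at \<open>g\<close>, and
  its squared length is \<open>\<phi>(g; \<theta>)\<close>.\<close>

section \<open>Functional calculus for skew operators\<close>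

text \<open>A maximiser \<open>e\<close> of the Rayleigh quotient on the unit sphere of
  \<open>W\<close> is an eigenvector: if the residual \<open>y = S e - c e\<close> were nonzero,
  moving \<open>e\<close> slightly along \<open>y\<close> would increase the quotient.\<close>

lemma selfadjoint_max_eigenvector:
  fixes S :: "'a::euclidean_space \<Rightarrow> 'a"
  assumes lin: "linear S" and sa: "\<And>x y. S x \<bullet> y = x \<bullet> S y"
    and W: "subspace W" and inv: "\<And>x. x \<in> W \<Longrightarrow> S x \<in> W" and ne: "W \<noteq> {0}"
  obtains e c where "e \<in> W" "norm e = 1" "S e = c *\<^sub>R e"
proof -
  obtain w where w: "w \<in> W" "w \<noteq> 0"
    using ne W subspace_0 by blast
  have "compact (W \<inter> sphere 0 1)"
    using W by (intro closed_Int_compact closed_subspace) auto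
  moreover have "w /\<^sub>R norm w \<in> W \<inter> sphere 0 1"
    using w W by (auto simp: subspace_scale)
  moreover have "continuous_on (W \<inter> sphere 0 1) (\<lambda>x. x \<bullet> S x)"
    by (intro continuous_intros linear_continuous_on linear_conv_bounded_linear[THEN iffD1] lin)
  ultimately obtain e where e: "e \<in> W" "norm e = 1"
    and max: "\<And>y. y \<in> W \<Longrightarrow> norm y = 1 \<Longrightarrow> y \<bullet> S y \<le> e \<bullet> S e"
    using continuous_attains_sup[of "W \<inter> sphere 0 1" "\<lambda>x. x \<bullet> S x"] by fastforce
  define c where "c = e \<bullet> S e"
  have nonneg: "y \<bullet> S y \<le> c * (y \<bullet> y)" if "y \<in> W" for y
  proof (cases "y = 0")
    case False
    have "(y /\<^sub>R norm y) \<bullet> S (y /\<^sub>R norm y) \<le> c"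
      unfolding c_def using False that W by (intro max) (auto simp: subspace_scale)
    then have "(y \<bullet> S y) / (norm y)^2 \<le> c"
      by (simp add: linear_cmul[OF lin] power2_eq_square field_simps)
    then show ?thesis
      using False by (simp add: field_simps power2_norm_eq_inner)
  qed simp
  define y where "y = S e - c *\<^sub>R e"
  have y: "y \<in> W"
    unfolding y_def using e inv W by (simp add: subspace_diff subspace_scale)
  have ye: "y \<bullet> S e = y \<bullet> y + c * (y \<bullet> e)"
    unfolding y_def by (simp add: inner_diff_left inner_diff_right algebra_simps inner_commute)
  \<comment> \<open>The terms with \<open>y \<bullet> e\<close> cancel, so the only first-order term
    left is \<open>2 t (y \<bullet> y)\<close>; a small positive \<open>t\<close> contradicts the
    inequality unless \<open>y = 0\<close>.\<close>
  have q: "2 * t * (y \<bullet> y) \<le> t\<^sup>2 * (c * (y \<bullet> y) - y \<bullet> S y)" for t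
  proof -
    have "(e + t *\<^sub>R y) \<bullet> S (e + t *\<^sub>R y) \<le> c * ((e + t *\<^sub>R y) \<bullet> (e + t *\<^sub>R y))"
      using e y W by (intro nonneg) (simp add: subspace_add subspace_scale)
    moreover have "(e + t *\<^sub>R y) \<bullet> S (e + t *\<^sub>R y) = c + 2 * t * (y \<bullet> S e) + t\<^sup>2 * (y \<bullet> S y)"
      using sa[of e y]
      by (simp add: c_def linear_add[OF lin] linear_cmul[OF lin] inner_add_left inner_add_right
          power2_eq_square algebra_simps inner_commute)
    moreover have "(e + t *\<^sub>R y) \<bullet> (e + t *\<^sub>R y) = 1 + 2 * t * (y \<bullet> e) + t\<^sup>2 * (y \<bullet> y)"
      using e(2) by (simp add: inner_add_left inner_add_right power2_eq_square algebra_simps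
          inner_commute norm_eq_1)
    ultimately have "c + 2 * t * (y \<bullet> y + c * (y \<bullet> e)) + t\<^sup>2 * (y \<bullet> S y)
        \<le> c * (1 + 2 * t * (y \<bullet> e) + t\<^sup>2 * (y \<bullet> y))"
      by (simp only: ye)
    then show ?thesis by (simp add: algebra_simps)
  qed
  have "y \<bullet> y = 0"
  proof (rule ccontr)
    assume "y \<bullet> y \<noteq> 0"
    then have pos: "y \<bullet> y > 0" by simp
    \<comment> \<open>\<open>K\<close> is a positive bound for the quadratic coefficient; at
      \<open>t = (y \<bullet> y) / K\<close> the linear term dominates.\<close>
    define K where "K = \<bar>c * (y \<bullet> y) - y \<bullet> S y\<bar> + 1"
    have K: "K > 0" "c * (y \<bullet> y) - y \<bullet> S y \<le> K" by (auto simp: K_def)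
    have "2 * (y \<bullet> y / K) * (y \<bullet> y) \<le> (y \<bullet> y / K)\<^sup>2 * K"
      using q[of "y \<bullet> y / K"] mult_left_mono[OF K(2), of "(y \<bullet> y / K)\<^sup>2"] by simp
    then have "2 * (y \<bullet> y)\<^sup>2 \<le> (y \<bullet> y)\<^sup>2"
      using K(1) by (simp add: field_simps power2_eq_square)
    moreover have "(y \<bullet> y)\<^sup>2 > 0" using pos by simp
    ultimately show False by linarith
  qed
  then have "S e = c *\<^sub>R e" by (simp add: y_def)
  with e show ?thesis by (rule that)
qed

text \<open>Induction on the dimension: the orthogonal complement of an eigenvector inside
  \<open>W\<close> is again invariant, because \<open>S\<close> is self-adjoint.\<close>

lemma selfadjoint_eigenbasis_subspace:
  fixes S :: "'a::euclidean_space \<Rightarrow> 'a"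
  assumes lin: "linear S" and sa: "\<And>x y. S x \<bullet> y = x \<bullet> S y"
    and "subspace W" and "\<And>x. x \<in> W \<Longrightarrow> S x \<in> W"
  shows "\<exists>B. pairwise orthogonal B \<and> (\<forall>e\<in>B. norm e = 1 \<and> (\<exists>c. S e = c *\<^sub>R e)) \<and> span B = W"
  using assms(3,4)
proof (induction "dim W" arbitrary: W rule: less_induct)
  case less
  show ?case
  proof (cases "W = {0}")
    case True
    then show ?thesis by (intro exI[of _ "{}"]) auto
  next
    case False
    obtain e c where e: "e \<in> W" "norm e = 1" "S e = c *\<^sub>R e"
      using selfadjoint_max_eigenvector[OF lin sa less.prems False] by blast
    define W' where "W' = {y \<in> W. e \<bullet> y = 0}"
    have sub: "subspace W'"
      using less.prems(1) unfolding W'_def subspace_def by (auto simp: inner_add_right)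
    have inv: "S x \<in> W'" if "x \<in> W'" for x
      using that less.prems(2)[of x] unfolding W'_def by (simp add: sa[of e x, symmetric] e(3))
    have "e \<notin> W'" using e by (auto simp: W'_def norm_eq_1)
    moreover have "W' \<subseteq> W" by (auto simp: W'_def)
    ultimately have "W' \<subset> W" using e by blast
    then have "dim W' < dim W"
      using sub less.prems(1) by (intro dim_psubset) (simp add: span_eq_iff[THEN iffD2])
    then obtain B where B: "pairwise orthogonal B" "\<forall>e\<in>B. norm e = 1 \<and> (\<exists>c. S e = c *\<^sub>R e)" "span B = W'"
      using less.hyps[OF _ sub inv] by blast
    have BW: "B \<subseteq> W'" using B(3) span_superset by blast
    have "pairwise orthogonal (insert e B)"
      using B(1) BW by (auto simp: pairwise_insert W'_def orthogonal_def inner_commute)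
    moreover have "span (insert e B) = W"
    proof
      show "span (insert e B) \<subseteq> W"
        using e BW less.prems(1) by (intro span_minimal) (auto simp: W'_def)
      show "W \<subseteq> span (insert e B)"
      proof
        fix x assume x: "x \<in> W"
        have "x - (e \<bullet> x) *\<^sub>R e \<in> W'"
          using x e less.prems(1)
          by (auto simp: W'_def inner_diff_right norm_eq_1 subspace_diff subspace_scale)
        then show "x \<in> span (insert e B)"
          using B(3) span_breakdown_eq by blast
      qed
    qed
    ultimately show ?thesis using B(2) e by (intro exI[of _ "insert e B"]) auto
  qed
qed

section \<open>Skew operators and their even functions\<close>

definition skew :: "('a::real_inner \<Rightarrow> 'a) \<Rightarrow> bool" where
  "skew A \<longleftrightarrow> linear A \<and> (\<forall>x y. A x \<bullet> y = - (x \<bullet> A y))"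

lemma skew_linear: "skew A \<Longrightarrow> linear A"
  and skew_swap: "skew A \<Longrightarrow> A x \<bullet> y = - (x \<bullet> A y)"
  by (auto simp: skew_def)

lemma skew_self: "skew A \<Longrightarrow> A x \<bullet> x = 0" "skew A \<Longrightarrow> x \<bullet> A x = 0"
  using skew_swap[of A x x] by (auto simp: inner_commute)

lemma skew_bounded_linear: "skew A \<Longrightarrow> bounded_linear (A :: 'a::euclidean_space \<Rightarrow> 'a)"
  by (simp add: skew_linear linear_conv_bounded_linear[symmetric])

text \<open>A nonzero skew operator has no real eigenbasis, but its square is self-adjoint and has
  one. The eigenvalue at a unit vector \<open>e\<close> is \<open>- m^2\<close> with
  \<open>m = norm (A e)\<close>, so these norms are the absolute values of the eigenvalues of the
  Hermitian operator \<open>\<i> A\<close>.\<close>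

definition skew_eigenbasis :: "('a::euclidean_space \<Rightarrow> 'a) \<Rightarrow> 'a set" where
  "skew_eigenbasis A = (SOME B. pairwise orthogonal B \<and>
     (\<forall>e\<in>B. norm e = 1 \<and> A (A e) = - ((norm (A e))\<^sup>2 *\<^sub>R e)) \<and> span B = UNIV)"

lemma skew_eigenbasis:
  assumes "skew A"
  shows "pairwise orthogonal (skew_eigenbasis A)"
    and "e \<in> skew_eigenbasis A \<Longrightarrow> norm e = 1"
    and "e \<in> skew_eigenbasis A \<Longrightarrow> A (A e) = - ((norm (A e))\<^sup>2 *\<^sub>R e)"
    and "span (skew_eigenbasis A) = UNIV"
proof -
  let ?P = "\<lambda>B. pairwise orthogonal B \<and>
     (\<forall>e\<in>B. norm e = 1 \<and> A (A e) = - ((norm (A e))\<^sup>2 *\<^sub>R e)) \<and> span B = UNIV"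
  have "linear (\<lambda>x. A (A x))"
    using linear_compose[OF skew_linear[OF assms] skew_linear[OF assms]] by (simp add: o_def)
  moreover have "A (A x) \<bullet> y = x \<bullet> A (A y)" for x y
    by (simp add: skew_swap[OF assms])
  ultimately have "\<exists>B. pairwise orthogonal B \<and>
      (\<forall>e\<in>B. norm e = 1 \<and> (\<exists>c. A (A e) = c *\<^sub>R e)) \<and> span B = UNIV"
    by (rule selfadjoint_eigenbasis_subspace) simp_all
  then obtain B where B: "pairwise orthogonal B"
      "\<forall>e\<in>B. norm e = 1 \<and> (\<exists>c. A (A e) = c *\<^sub>R e)" "span B = UNIV"
    by blast
  have "A (A e) = - ((norm (A e))\<^sup>2 *\<^sub>R e)" if eB: "e \<in> B" for e
  proof -
    obtain c where c: "A (A e) = c *\<^sub>R e" using B(2) eB by blast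
    have "e \<bullet> e = 1" using B(2) that norm_eq_1 by blast
    then have "c = A (A e) \<bullet> e" by (simp add: c)
    also have "\<dots> = - (norm (A e))\<^sup>2"
      by (simp only: skew_swap[OF assms, of "A e" e] power2_norm_eq_inner)
    finally show ?thesis using c by simp
  qed
  then have "?P B" using B by simp
  then have "\<exists>B. ?P B" by (rule exI)
  then have "?P (skew_eigenbasis A)" unfolding skew_eigenbasis_def by (rule someI_ex)
  then show "pairwise orthogonal (skew_eigenbasis A)"
    and "e \<in> skew_eigenbasis A \<Longrightarrow> norm e = 1"
    and "e \<in> skew_eigenbasis A \<Longrightarrow> A (A e) = - ((norm (A e))\<^sup>2 *\<^sub>R e)"
    and "span (skew_eigenbasis A) = UNIV" by auto
qed

lemma finite_skew_eigenbasis: "skew A \<Longrightarrow> finite (skew_eigenbasis A)"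
  using skew_eigenbasis(1) by (rule pairwise_orthogonal_imp_finite)

lemma skew_eigenbasis_inner:
  assumes "skew A" "e \<in> skew_eigenbasis A" "e' \<in> skew_eigenbasis A"
  shows "e \<bullet> e' = (if e = e' then 1 else 0)"
  using assms skew_eigenbasis[OF assms(1)]
  by (auto simp: norm_eq_1 pairwise_def orthogonal_def)

lemma skew_eigenbasis_expand:
  assumes "skew A"
  shows "(\<Sum>e\<in>skew_eigenbasis A. (x \<bullet> e) *\<^sub>R e) = x"
  using skew_eigenbasis[OF assms] finite_skew_eigenbasis[OF assms]
  by (intro orthonormal_basis_expand) auto

lemma skew_eigenbasis_inner_expand:
  assumes "skew A"
  shows "x \<bullet> y = (\<Sum>e\<in>skew_eigenbasis A. (x \<bullet> e) * (y \<bullet> e))"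
proof -
  have "x \<bullet> y = (\<Sum>e\<in>skew_eigenbasis A. (x \<bullet> e) *\<^sub>R e) \<bullet> y"
    by (simp only: skew_eigenbasis_expand[OF assms])
  then show ?thesis by (simp add: inner_sum_left inner_commute[of y])
qed

lemma skew_eigenbasis_eqI:
  assumes "skew A" "\<And>e. e \<in> skew_eigenbasis A \<Longrightarrow> x \<bullet> e = y \<bullet> e"
  shows "x = y"
proof -
  have "x = (\<Sum>e\<in>skew_eigenbasis A. (x \<bullet> e) *\<^sub>R e)"
    by (simp only: skew_eigenbasis_expand[OF assms(1)])
  also have "\<dots> = (\<Sum>e\<in>skew_eigenbasis A. (y \<bullet> e) *\<^sub>R e)"
    using assms(2) by simp
  finally show ?thesis by (simp only: skew_eigenbasis_expand[OF assms(1)])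
qed

text \<open>For even \<open>f\<close> this is \<open>f\<close> applied to the Hermitian operator \<open>\<i> A\<close>: on the
  \<open>\<mu>\<close>-eigenspace of \<open>\<surd>(-A\<^sup>2)\<close> it is multiplication by \<open>f \<mu>\<close>.\<close>

definition skew_fun :: "('a::euclidean_space \<Rightarrow> 'a) \<Rightarrow> (real \<Rightarrow> real) \<Rightarrow> 'a \<Rightarrow> 'a" where
  "skew_fun A f x = (\<Sum>e\<in>skew_eigenbasis A. (f (norm (A e)) * (x \<bullet> e)) *\<^sub>R e)"

lemma skew_fun_inner_eigenbasis:
  assumes "skew A" "e \<in> skew_eigenbasis A"
  shows "skew_fun A f x \<bullet> e = f (norm (A e)) * (x \<bullet> e)"
proof -
  have "skew_fun A f x \<bullet> e
      = (\<Sum>e'\<in>skew_eigenbasis A. if e' = e then f (norm (A e)) * (x \<bullet> e) else 0)"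
    unfolding skew_fun_def inner_sum_left
    by (intro sum.cong) (auto simp: skew_eigenbasis_inner[OF assms(1) _ assms(2)])
  then show ?thesis using assms(2) by (simp add: finite_skew_eigenbasis[OF assms(1)])
qed

lemma skew_fun_inner:
  assumes "skew A"
  shows "skew_fun A f x \<bullet> y = (\<Sum>e\<in>skew_eigenbasis A. f (norm (A e)) * (x \<bullet> e) * (y \<bullet> e))"
  unfolding skew_fun_def inner_sum_left by (simp add: inner_commute)

lemma skew_fun_comp:
  assumes "skew A"
  shows "skew_fun A f (skew_fun A g x) = skew_fun A (\<lambda>m. f m * g m) x"
  by (rule skew_eigenbasis_eqI[OF assms]) (simp add: skew_fun_inner_eigenbasis[OF assms])

lemma skew_fun_one: "skew A \<Longrightarrow> skew_fun A (\<lambda>m. 1) x = x"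
  by (simp add: skew_fun_def skew_eigenbasis_expand)

lemma skew_fun_add: "skew_fun A f x + skew_fun A g x = skew_fun A (\<lambda>m. f m + g m) x"
  by (simp add: skew_fun_def sum.distrib[symmetric] algebra_simps)

lemma linear_skew_fun: "linear (skew_fun A f)"
  by (rule linearI) (simp_all add: skew_fun_def inner_add_left algebra_simps sum.distrib scaleR_sum_right)

text \<open>\<open>A\<close> preserves the eigenspaces of its square, so
  \<open>e' \<bullet> A e\<close> vanishes unless \<open>norm (A e') = norm (A e)\<close>. Hence
  \<open>f\<close> may be evaluated at either of the two basis vectors.\<close>

lemma skew_commute_skew_fun:
  assumes "skew A"
  shows "A (skew_fun A f x) = skew_fun A f (A x)"
proof (rule skew_eigenbasis_eqI[OF assms])
  fix e assume e: "e \<in> skew_eigenbasis A"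
  have eq: "f (norm (A e')) * (e' \<bullet> A e) = f (norm (A e)) * (e' \<bullet> A e)"
    if e': "e' \<in> skew_eigenbasis A" for e'
  proof (cases "e' \<bullet> A e = 0")
    case False
    have "A (A e') \<bullet> A e = e' \<bullet> A (A (A e))"
      by (simp add: skew_swap[OF assms])
    then have "(norm (A e'))\<^sup>2 * (e' \<bullet> A e) = (norm (A e))\<^sup>2 * (e' \<bullet> A e)"
      using skew_linear[OF assms]
      by (simp add: skew_eigenbasis(3)[OF assms e] skew_eigenbasis(3)[OF assms e'] linear_neg linear_cmul)
    then show ?thesis using False by simp
  qed simp
  have "A (skew_fun A f x) \<bullet> e = - (skew_fun A f x \<bullet> A e)"
    by (rule skew_swap[OF assms])
  also have "\<dots> = - (\<Sum>e'\<in>skew_eigenbasis A. (x \<bullet> e') * (f (norm (A e')) * (e' \<bullet> A e)))"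
    by (simp add: skew_fun_inner[OF assms] mult_ac inner_commute[of "A e"])
  also have "\<dots> = - (\<Sum>e'\<in>skew_eigenbasis A. (x \<bullet> e') * (f (norm (A e)) * (e' \<bullet> A e)))"
    using eq by (simp only: cong: sum.cong)
  also have "\<dots> = f (norm (A e)) * - (x \<bullet> A e)"
    by (simp add: skew_eigenbasis_inner_expand[OF assms, of x "A e"] sum_distrib_left mult_ac
        inner_commute[of "A e"])
  also have "\<dots> = skew_fun A f (A x) \<bullet> e"
    by (simp add: skew_fun_inner_eigenbasis[OF assms e] skew_swap[OF assms])
  finally show "A (skew_fun A f x) \<bullet> e = skew_fun A f (A x) \<bullet> e" .
qed

lemma skew_fun_selfadjoint:
  "skew A \<Longrightarrow> skew_fun A f x \<bullet> y = x \<bullet> skew_fun A f y"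
  by (simp add: skew_fun_inner inner_commute[of x] mult_ac)

text \<open>The composite of \<open>A\<close> with a commuting self-adjoint operator is skew, so its
  quadratic form vanishes. This removes the mixed term in \<open>cot_energy_step\<close>.\<close>

lemma skew_fun_inner_skew:
  assumes "skew A"
  shows "skew_fun A f x \<bullet> A x = 0"
proof -
  have "skew_fun A f x \<bullet> A x = - (A (skew_fun A f x) \<bullet> x)"
    by (simp add: skew_swap[OF assms])
  also have "\<dots> = - (skew_fun A f x \<bullet> A x)"
    by (simp add: skew_commute_skew_fun[OF assms] skew_fun_selfadjoint[OF assms] inner_commute[of x])
  finally show ?thesis by simp
qed

lemma skew_square:
  assumes "skew A"
  shows "A (A x) = - skew_fun A (\<lambda>m. m\<^sup>2) x"
proof (rule skew_eigenbasis_eqI[OF assms])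
  fix e assume e: "e \<in> skew_eigenbasis A"
  have "A (A x) \<bullet> e = x \<bullet> A (A e)" by (simp add: skew_swap[OF assms])
  then show "A (A x) \<bullet> e = - skew_fun A (\<lambda>m. m\<^sup>2) x \<bullet> e"
    by (simp add: skew_eigenbasis(3)[OF assms e] skew_fun_inner_eigenbasis[OF assms e])
qed

lemma skew_fun_inner_skew_skew:
  assumes "skew A"
  shows "skew_fun A f (A x) \<bullet> A x = skew_fun A (\<lambda>m. f m * m\<^sup>2) x \<bullet> x"
proof -
  have "skew_fun A f (A x) \<bullet> A x = - (A (skew_fun A f (A x)) \<bullet> x)"
    by (simp add: skew_swap[OF assms])
  also have "\<dots> = skew_fun A f (skew_fun A (\<lambda>m. m\<^sup>2) x) \<bullet> x"
    by (simp add: skew_commute_skew_fun[OF assms] skew_square[OF assms] linear_neg[OF linear_skew_fun])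
  finally show ?thesis by (simp add: skew_fun_comp[OF assms])
qed

lemma skew_eigenvalue_less:
  assumes "skew A" "onorm A < r" "e \<in> skew_eigenbasis A"
  shows "norm (A e) < r"
  using onorm[OF skew_bounded_linear[OF assms(1)], of e] assms skew_eigenbasis(2)[OF assms(1,3)] by simp

section \<open>The Riccati inequality\<close>

lemma mult_cos_le_sin:
  fixes p :: real
  assumes "0 \<le> p" "p \<le> pi"
  shows "p * cos p \<le> sin p"
proof -
  have "(\<lambda>p. sin p - p * cos p) 0 \<le> (\<lambda>p. sin p - p * cos p) p"
  proof (rule DERIV_nonneg_imp_nondecreasing[OF assms(1)])
    fix x assume x: "0 \<le> x" "x \<le> p"
    have "((\<lambda>p. sin p - p * cos p) has_real_derivative x * sin x) (at x)"
      by (auto intro!: derivative_eq_intros)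
    moreover have "0 \<le> x * sin x" using x assms by (intro mult_nonneg_nonneg sin_ge_zero) auto
    ultimately show "\<exists>y. ((\<lambda>p. sin p - p * cos p) has_real_derivative y) (at x) \<and> 0 \<le> y" by blast
  qed
  then show ?thesis by simp
qed

lemma cot_diff_eq:
  fixes p q :: real
  assumes "sin p \<noteq> 0" "sin q \<noteq> 0"
  shows "cot p - cot q = sin (q - p) / (sin p * sin q)"
  using assms by (simp add: cot_def sin_diff field_simps)

text \<open>The value at \<open>m = 0\<close> is the limit of \<open>m cot (s m)\<close>. At
  \<open>s = 1\<close> this is the real form of \<open>zcot\<close>.\<close>

definition cot_time :: "real \<Rightarrow> real \<Rightarrow> real" where
  "cot_time s m = (if m = 0 then 1 / s else m * cot (s * m))"

lemma sin_mult_pos: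
  assumes "0 < s" "s \<le> 1" "0 < m" "m < pi"
  shows "sin (s * m) > 0"
proof -
  have "s * m \<le> 1 * m" using assms by (intro mult_right_mono) auto
  then show ?thesis using assms by (intro sin_gt_zero) (simp, linarith)
qed

lemma cot_time_diff:
  assumes "0 < s" "s < s'" "s' \<le> 1" "0 < m" "m < pi"
  shows "sin (s * m) > 0" "sin (s' * m) > 0"
    "cot_time s m - cot_time s' m = m * sin ((s' - s) * m) / (sin (s * m) * sin (s' * m))"
proof -
  show pos: "sin (s * m) > 0" "sin (s' * m) > 0"
    using assms by (auto intro!: sin_mult_pos)
  have "cot_time s m - cot_time s' m = m * (cot (s * m) - cot (s' * m))"
    using assms by (simp add: cot_time_def algebra_simps)
  also have "cot (s * m) - cot (s' * m) = sin ((s' - s) * m) / (sin (s * m) * sin (s' * m))"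
    using pos cot_diff_eq[of "s * m" "s' * m"] by (simp add: left_diff_distrib)
  finally show "cot_time s m - cot_time s' m = m * sin ((s' - s) * m) / (sin (s * m) * sin (s' * m))"
    by simp
qed

text \<open>The sines in \<open>cot_time_diff\<close> are all positive below \<open>pi\<close>. The
  strict inequality makes the weights positive by which \<open>cot_energy_step\<close>
  divides.\<close>

lemma cot_time_strict_antimono:
  assumes "0 < s" "s < s'" "s' \<le> 1" "0 \<le> m" "m < pi"
  shows "cot_time s' m < cot_time s m"
proof (cases "m = 0")
  case True
  then show ?thesis using assms by (simp add: cot_time_def divide_strict_left_mono)
next
  case False
  have "sin ((s' - s) * m) > 0" using assms False by (intro sin_mult_pos) auto
  then have "cot_time s m - cot_time s' m > 0"
    using cot_time_diff[of s s' m] assms False by simp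
  then show ?thesis by simp
qed

lemma cot_time_le:
  assumes "0 < s" "s \<le> 1" "0 \<le> m" "m < pi"
  shows "cot_time s m \<le> 1 / s"
proof (cases "m = 0")
  case False
  have "s * m \<le> 1 * m" using assms by (intro mult_right_mono) auto
  then have "s * m * cos (s * m) \<le> sin (s * m)"
    using assms by (intro mult_cos_le_sin) auto
  moreover have "sin (s * m) > 0" using assms False by (intro sin_mult_pos) auto
  ultimately
  show ?thesis using assms False
    by (simp add: cot_time_def cot_def field_simps)
qed (simp add: cot_time_def)

text \<open>Discrete form of the Riccati equation \<open>k' = - k\<^sup>2 - m\<^sup>2\<close> solved by \<open>s \<mapsto> m cot (s m)\<close>.\<close>

lemma cot_time_Riccati:
  assumes "0 < s" "0 < h" "s + h \<le> 1" "0 \<le> m" "m < pi"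
  shows "(cot_time h m - cot_time (s + h) m) * (cot_time s m - cot_time (s + h) m)
    = (cot_time (s + h) m)\<^sup>2 + m\<^sup>2"
proof (cases "m = 0")
  case True
  have "1 / h - 1 / (s + h) = s / (h * (s + h))" "1 / s - 1 / (s + h) = h / (s * (s + h))"
    using assms by (simp_all add: field_simps)
  then show ?thesis using assms True
    by (simp add: cot_time_def power2_eq_square)
next
  case False
  then have m: "0 < m" using assms by simp
  note h = cot_time_diff[of h "s + h" m] and s = cot_time_diff[of s "s + h" m]
  have pos: "sin (h * m) > 0" "sin (s * m) > 0" "sin ((s + h) * m) > 0"
    using h(1) s(1,2) assms m by auto
  have "(cot_time h m - cot_time (s + h) m) * (cot_time s m - cot_time (s + h) m)
      = m\<^sup>2 / (sin ((s + h) * m))\<^sup>2"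
    using h(3) s(3) assms m pos by (simp add: power2_eq_square)
  also have "\<dots> = (cot_time (s + h) m)\<^sup>2 + m\<^sup>2"
  proof -
    have "m\<^sup>2 * 1 / S\<^sup>2 = (m * (C / S))\<^sup>2 + m\<^sup>2" if "S > 0" "C\<^sup>2 + S\<^sup>2 = 1" for C S :: real
      using that(1) unfolding that(2)[symmetric] by (simp add: field_simps)
    from this[OF pos(3), of "cos ((s + h) * m)"] show ?thesis
      using m by (simp add: cot_time_def cot_def)
  qed
  finally show ?thesis .
qed

text \<open>The least energy \<open>\<integral> |x'|\<^sup>2 - 2 \<langle>A x, x'\<rangle>\<close> of a path from \<open>0\<close> to \<open>x\<close> in time \<open>s\<close>.\<close>

definition cot_energy :: "('a::euclidean_space \<Rightarrow> 'a) \<Rightarrow> real \<Rightarrow> 'a \<Rightarrow> real" where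
  "cot_energy A s x = skew_fun A (cot_time s) x \<bullet> x"

lemma cot_energy_sum:
  "skew A \<Longrightarrow> cot_energy A s x = (\<Sum>e\<in>skew_eigenbasis A. cot_time s (norm (A e)) * (x \<bullet> e)\<^sup>2)"
  by (simp add: cot_energy_def skew_fun_inner power2_eq_square mult_ac)

lemma norm_skew_eigenbasis_sum:
  "skew A \<Longrightarrow> (norm x)\<^sup>2 = (\<Sum>e\<in>skew_eigenbasis A. (x \<bullet> e)\<^sup>2)"
  unfolding power2_norm_eq_inner by (simp add: skew_eigenbasis_inner_expand[of A x x] power2_eq_square)

text \<open>The right side is the energy of the segment from \<open>0\<close> to \<open>x\<close>
  run through at constant speed, along which the magnetic term vanishes. The estimate holds
  separately for each basis vector.\<close>

lemma cot_energy_le: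
  assumes A: "skew A" and "onorm A < pi" "0 < s" "s \<le> 1"
  shows "cot_energy A s x \<le> (norm x)\<^sup>2 / s"
proof -
  have "cot_energy A s x \<le> (\<Sum>e\<in>skew_eigenbasis A. 1 / s * (x \<bullet> e)\<^sup>2)"
    unfolding cot_energy_sum[OF A] using assms skew_eigenvalue_less[OF A assms(2)]
    by (intro sum_mono mult_right_mono cot_time_le) auto
  also have "\<dots> = (norm x)\<^sup>2 / s"
    by (simp add: norm_skew_eigenbasis_sum[OF A] sum_divide_distrib)
  finally show ?thesis .
qed

text \<open>The defect of the inequality is the square completed with \<open>P = k\<^sub>h(A) - k\<^bsub>s+h\<^esub>(A) > 0\<close>,
  where \<open>k\<close> is \<open>cot_time\<close>; the discrete Riccati equation makes the completion exact.\<close>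

lemma cot_energy_step:
  assumes A: "skew A" and pi: "onorm A < pi" and s: "0 < s" "0 < h" "s + h \<le> 1"
  shows "cot_energy A (s + h) (x + D) + 2 * (A x \<bullet> D) \<le> cot_energy A s x + (norm D)\<^sup>2 / h"
proof -
  define k0 where "k0 m = cot_time s m" for m
  define k1 where "k1 m = cot_time (s + h) m" for m
  define kh where "kh m = cot_time h m" for m
  define p where "p m = kh m - k1 m" for m
  \<comment> \<open>Half the linear coefficient of \<open>D \<bullet> e\<close> in the form to be
    minimised: the optimal edge has coordinates \<open>w e / p (norm (A e))\<close>.\<close>
  define w where "w e = k1 (norm (A e)) * (x \<bullet> e) + A x \<bullet> e" for e
  let ?B = "skew_eigenbasis A"
  have mpi: "norm (A e) < pi" if "e \<in> ?B" for e
    using skew_eigenvalue_less[OF A pi that] .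
  have p: "p (norm (A e)) > 0" if "e \<in> ?B" for e
    using cot_time_strict_antimono[of h "s + h" "norm (A e)"] s mpi[OF that]
    by (simp add: p_def kh_def k1_def)
  have ric: "k0 m - k1 m = ((k1 m)\<^sup>2 + m\<^sup>2) / p m" if "m \<in> (\<lambda>e. norm (A e)) ` ?B" for m
  proof -
    have "p m * (k0 m - k1 m) = (k1 m)\<^sup>2 + m\<^sup>2"
      using cot_time_Riccati[of s h m] s mpi that by (auto simp: p_def kh_def k1_def k0_def)
    then show ?thesis using p that by (force simp: field_simps)
  qed
  \<comment> \<open>After expanding the squares, the mixed sum is the quadratic form of a skew
    operator, hence zero, and in the last sum \<open>(A x \<bullet> e)^2\<close> can be exchanged
    for \<open>m^2 (x \<bullet> e)^2\<close>. The rest is \<open>ric\<close>.\<close>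
  have w: "(\<Sum>e\<in>?B. (w e)\<^sup>2 / p (norm (A e))) = (\<Sum>e\<in>?B. (k0 (norm (A e)) - k1 (norm (A e))) * (x \<bullet> e)\<^sup>2)"
  proof -
    have "(\<Sum>e\<in>?B. (w e)\<^sup>2 / p (norm (A e)))
       = (\<Sum>e\<in>?B. (k1 (norm (A e)))\<^sup>2 / p (norm (A e)) * (x \<bullet> e)\<^sup>2)
        + 2 * (\<Sum>e\<in>?B. k1 (norm (A e)) / p (norm (A e)) * (x \<bullet> e) * (A x \<bullet> e))
        + (\<Sum>e\<in>?B. 1 / p (norm (A e)) * (A x \<bullet> e) * (A x \<bullet> e))"
      unfolding sum_distrib_left sum.distrib[symmetric]
      by (intro sum.cong) (auto simp: w_def power2_eq_square algebra_simps add_divide_distrib)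
    also have "(\<Sum>e\<in>?B. k1 (norm (A e)) / p (norm (A e)) * (x \<bullet> e) * (A x \<bullet> e)) = 0"
      using skew_fun_inner_skew[OF A, of "\<lambda>m. k1 m / p m" x] unfolding skew_fun_inner[OF A] .
    also have "(\<Sum>e\<in>?B. 1 / p (norm (A e)) * (A x \<bullet> e) * (A x \<bullet> e))
        = (\<Sum>e\<in>?B. 1 / p (norm (A e)) * (norm (A e))\<^sup>2 * (x \<bullet> e) * (x \<bullet> e))"
      using skew_fun_inner_skew_skew[OF A, of "\<lambda>m. 1 / p m" x] unfolding skew_fun_inner[OF A] .
    also have "(\<Sum>e\<in>?B. (k1 (norm (A e)))\<^sup>2 / p (norm (A e)) * (x \<bullet> e)\<^sup>2) + 2 * 0 + \<dots>
        = (\<Sum>e\<in>?B. (k0 (norm (A e)) - k1 (norm (A e))) * (x \<bullet> e)\<^sup>2)"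
      by (simp add: ric sum.distrib[symmetric] power2_eq_square algebra_simps add_divide_distrib)
    finally show ?thesis .
  qed
  have "0 \<le> (\<Sum>e\<in>?B. p (norm (A e)) * (D \<bullet> e - w e / p (norm (A e)))\<^sup>2)"
    using p by (intro sum_nonneg mult_nonneg_nonneg) (auto intro: less_imp_le)
  also have "\<dots> = (\<Sum>e\<in>?B. p (norm (A e)) * (D \<bullet> e)\<^sup>2 - 2 * (w e * (D \<bullet> e)) + (w e)\<^sup>2 / p (norm (A e)))"
    using p by (intro sum.cong refl) (force simp: power2_eq_square field_simps)
  also have "\<dots> = (\<Sum>e\<in>?B. p (norm (A e)) * (D \<bullet> e)\<^sup>2 - 2 * (w e * (D \<bullet> e)))
      + (\<Sum>e\<in>?B. (w e)\<^sup>2 / p (norm (A e)))"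
    by (simp add: sum.distrib)
  also have "\<dots> = (\<Sum>e\<in>?B. kh (norm (A e)) * (D \<bullet> e)\<^sup>2 + k0 (norm (A e)) * (x \<bullet> e)\<^sup>2
      - k1 (norm (A e)) * ((x + D) \<bullet> e)\<^sup>2 - 2 * ((A x \<bullet> e) * (D \<bullet> e)))"
    unfolding w sum.distrib[symmetric]
    by (intro sum.cong) (auto simp: p_def w_def power2_eq_square algebra_simps inner_add_left)
  also have "\<dots> = cot_energy A h D + cot_energy A s x - cot_energy A (s + h) (x + D) - 2 * (A x \<bullet> D)"
    by (simp add: cot_energy_sum[OF A] kh_def k0_def k1_def skew_eigenbasis_inner_expand[OF A, of "A x" D]
        sum_distrib_left sum.distrib sum_subtractf)
  finally have "cot_energy A (s + h) (x + D) + 2 * (A x \<bullet> D) \<le> cot_energy A s x + cot_energy A h D"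
    by simp
  \<comment> \<open>The cost of the edge is relaxed to that of a straight segment, which involves
    only its length.\<close>
  moreover have "cot_energy A h D \<le> (norm D)\<^sup>2 / h"
    using s by (intro cot_energy_le A pi) auto
  ultimately show ?thesis by simp
qed

section \<open>Energy and length\<close>

text \<open>\<open>cot_energy_step\<close> is summed along the vertices; the sum with
  \<open>A (x i)\<close> is a left Riemann sum for the magnetic term. The induction starts after the
  first edge because the step needs \<open>0 < s\<close>; on that edge the magnetic term vanishes
  since \<open>x 0 = 0\<close>.\<close>

lemma cot_energy_polygon:
  fixes x :: "nat \<Rightarrow> 'a::euclidean_space"
  assumes A: "skew A" and pi: "onorm A < pi" and "x 0 = 0" and h: "\<And>i. 0 < h i"
    and "(\<Sum>i<Suc n. h i) \<le> 1"
  shows "cot_energy A (\<Sum>i<Suc n. h i) (x (Suc n)) + 2 * (\<Sum>i<Suc n. A (x i) \<bullet> (x (Suc i) - x i))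
    \<le> (\<Sum>i<Suc n. (norm (x (Suc i) - x i))\<^sup>2 / h i)"
  using assms(5)
proof (induction n)
  case 0
  then show ?case
    using cot_energy_le[OF A pi, of "h 0" "x (Suc 0)"] h[of 0] \<open>x 0 = 0\<close> skew_linear[OF A]
    by (simp add: linear_0)
next
  case (Suc n)
  define s where "s = (\<Sum>i<Suc n. h i)"
  have "s > 0" unfolding s_def using h by (intro sum_pos) auto
  moreover have "s + h (Suc n) \<le> 1" using Suc.prems by (simp add: s_def)
  ultimately have "cot_energy A (s + h (Suc n)) (x (Suc n) + (x (Suc (Suc n)) - x (Suc n)))
      + 2 * (A (x (Suc n)) \<bullet> (x (Suc (Suc n)) - x (Suc n)))
      \<le> cot_energy A s (x (Suc n)) + (norm (x (Suc (Suc n)) - x (Suc n)))\<^sup>2 / h (Suc n)"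
    using h by (intro cot_energy_step A pi) auto
  moreover have "cot_energy A s (x (Suc n)) + 2 * (\<Sum>i<Suc n. A (x i) \<bullet> (x (Suc i) - x i))
    \<le> (\<Sum>i<Suc n. (norm (x (Suc i) - x i))\<^sup>2 / h i)"
    unfolding s_def using Suc.prems h[of "Suc n"] by (intro Suc.IH) simp
  ultimately show ?case
    by (simp add: s_def[symmetric] algebra_simps del: sum.lessThan_Suc add: sum.lessThan_Suc[of _ "Suc n"])
qed

lemma integral_diff_left:
  fixes f :: "real \<Rightarrow> 'a::banach"
  assumes "f integrable_on {0..1}" "0 \<le> a" "a \<le> b" "b \<le> 1"
  shows "integral {0..b} f - integral {0..a} f = integral {a..b} f"
  using Henstock_Kurzweil_Integration.integral_combine[of 0 a b f]
    integrable_on_subinterval[OF assms(1), of 0 b] assms by (auto simp: algebra_simps)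

lemma absolutely_integrable_linear_inner:
  fixes xd x :: "real \<Rightarrow> 'a::euclidean_space"
  assumes "linear A" and xd: "xd absolutely_integrable_on {0..1}" and x: "continuous_on {0..1} x"
  shows "(\<lambda>s. A (x s) \<bullet> xd s) absolutely_integrable_on {0..1}"
proof -
  have c: "continuous_on {0..1} (\<lambda>s. A (x s))"
    using linear_continuous_on_compose[OF x assms(1)] by (simp add: o_def)
  have "bilinear (\<lambda>a b. a \<bullet> (b::'a))"
    by (auto simp: bilinear_def intro!: linearI simp: inner_add_left inner_add_right)
  then show ?thesis
    using c xd
    by (intro absolutely_integrable_bounded_measurable_product[where h = "\<lambda>a b. a \<bullet> b"])
      (auto intro!: continuous_imp_measurable_on_sets_lebesgue compact_imp_bounded compact_continuous_image)
qed

text \<open>Inscribe a polygon whose \<open>i\<close>-th edge is run through in time proportional to the length of the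
  corresponding arc, up to an \<open>\<epsilon>\<close> that keeps the time steps positive; this replaces a
  reparametrisation by arc length.\<close>

theorem cot_energy_le_length_squared:
  fixes xd x :: "real \<Rightarrow> 'a::euclidean_space"
  assumes A: "skew A" and pi: "onorm A < pi" and xd: "xd absolutely_integrable_on {0..1}"
    and x: "\<And>s. s \<in> {0..1} \<Longrightarrow> x s = integral {0..s} xd"
  shows "cot_energy A 1 (x 1) + 2 * integral {0..1} (\<lambda>s. A (x s) \<bullet> xd s)
    \<le> (integral {0..1} (\<lambda>s. norm (xd s)))\<^sup>2"
proof -
  define L where "L = integral {0..1} (\<lambda>s. norm (xd s))"
  define G where "G = (\<lambda>s. A (x s) \<bullet> xd s)"
  have int: "xd integrable_on {0..1}" "(\<lambda>s. norm (xd s)) integrable_on {0..1}"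
    using xd by (auto simp: absolutely_integrable_on_def)
  have L0: "L \<ge> 0" unfolding L_def using int by (intro integral_nonneg) auto
  have cx: "continuous_on {0..1} x"
    by (rule continuous_on_eq[OF indefinite_integral_continuous_1[OF int(1)]]) (simp add: x)
  have intG: "G integrable_on {0..1}"
    using absolutely_integrable_linear_inner[OF skew_linear[OF A] xd cx]
    unfolding G_def absolutely_integrable_on_def by blast
  have "uniformly_continuous_on {0..1} x"
    using cx by (intro compact_uniformly_continuous) auto
  note uc = this[unfolded uniformly_continuous_on_def, rule_format]
  \<comment> \<open>Enlarging the total length to \<open>L + \<epsilon>\<close> costs
    \<open>\<epsilon> * L\<close>, and freezing \<open>A (x s)\<close> at the left end of each piece
    costs \<open>onorm A * \<epsilon> * L\<close>, which enters twice.\<close>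
  have main: "cot_energy A 1 (x 1) + 2 * integral {0..1} G \<le> L\<^sup>2 + \<epsilon> * (L + 2 * onorm A * L)"
    if \<epsilon>: "\<epsilon> > 0" for \<epsilon>
  proof -
    obtain \<delta> where \<delta>: "\<delta> > 0" "\<And>s t. s \<in> {0..1} \<Longrightarrow> t \<in> {0..1} \<Longrightarrow> dist t s < \<delta> \<Longrightarrow> dist (x t) (x s) < \<epsilon>"
      using uc[OF \<epsilon>] by meson
    obtain n where n: "1 / real (Suc n) < \<delta>"
      using nat_approx_posE[OF \<delta>(1)] by (auto simp: divide_inverse)
    define N where "N = Suc n"
    define t where "t i = real i / real N" for i
    have t: "0 \<le> t i" "t i \<le> t (Suc i)" "t (Suc i) \<le> 1" if "i < N" for i
      using that by (auto simp: t_def divide_right_mono)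
    have tN: "t 0 = 0" "t N = 1" by (auto simp: t_def N_def)
    have tstep: "t (Suc i) - t i < \<delta>" for i
      using n by (simp add: t_def N_def diff_divide_distrib[symmetric])
    define l where "l i = integral {t i..t (Suc i)} (\<lambda>s. norm (xd s))" for i
    have sub: "f integrable_on {t i..t (Suc i)}" if "f integrable_on {0..1}" "i < N"
      for f :: "real \<Rightarrow> 'b::banach" and i
      using integrable_on_subinterval[OF that(1)] t[OF that(2)] by auto
    \<comment> \<open>The polygon lemma wants positive time steps at all indices. Beyond
      \<open>N\<close> the norm of \<open>xd\<close> may fail to be integrable, and then the
      integral is \<open>0\<close> by default.\<close>
    have l0: "l i \<ge> 0" for i
      unfolding l_def
      by (cases "(\<lambda>s. norm (xd s)) integrable_on {t i..t (Suc i)}")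
        (auto intro: integral_nonneg simp: not_integrable_integral)
    have tele: "(\<Sum>i<N. integral {t i..t (Suc i)} f) = integral {0..1} f"
      if "f integrable_on {0..1}" for f :: "real \<Rightarrow> real"
    proof -
      have "(\<Sum>i<N. integral {t i..t (Suc i)} f)
          = (\<Sum>i<N. integral {0..t (Suc i)} f - integral {0..t i} f)"
        using integral_diff_left[OF that] t by simp
      also have "\<dots> = integral {0..t N} f - integral {0..t 0} f"
        by (rule sum_lessThan_telescope)
      finally show ?thesis by (simp add: tN)
    qed
    have suml: "(\<Sum>i<N. l i) = L"
      unfolding l_def L_def by (rule tele[OF int(2)])
    define y where "y i = x (t i)" for i
    have D: "y (Suc i) - y i = integral {t i..t (Suc i)} xd" if "i < N" for i
      using integral_diff_left[OF int(1) t[OF that]] t[OF that] by (simp add: y_def x)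
    have Dl: "norm (y (Suc i) - y i) \<le> l i" if "i < N" for i
      unfolding D[OF that] l_def
      using sub[OF int(1) that] sub[OF int(2) that]
      by (intro Henstock_Kurzweil_Integration.integral_norm_bound_integral) auto
    have y0: "y 0 = 0" by (simp add: y_def tN x)
    \<comment> \<open>Division by \<open>L + \<epsilon>\<close> makes the steps sum to
      \<open>1\<close>, and \<open>(l i)^2 / h i\<close> is at most
      \<open>l i * (L + \<epsilon>)\<close>.\<close>
    define h where "h i = (l i + \<epsilon> / N) / (L + \<epsilon>)" for i
    have N0: "real N > 0" by (simp add: N_def)
    have h: "h i > 0" for i
      unfolding h_def using l0[of i] L0 \<epsilon> N0 by (intro divide_pos_pos add_nonneg_pos) auto
    have sumh: "(\<Sum>i<N. h i) = 1"
      unfolding h_def sum_divide_distrib[symmetric] sum.distrib suml using L0 \<epsilon> N0 by simp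
    have poly: "cot_energy A 1 (x 1) + 2 * (\<Sum>i<N. A (y i) \<bullet> (y (Suc i) - y i))
        \<le> (\<Sum>i<N. (norm (y (Suc i) - y i))\<^sup>2 / h i)"
      using cot_energy_polygon[where x = y and h = h and n = n, OF A pi y0 h] sumh
      unfolding N_def[symmetric] sumh by (simp add: y_def tN)
    have "(\<Sum>i<N. (norm (y (Suc i) - y i))\<^sup>2 / h i) \<le> (\<Sum>i<N. l i * (L + \<epsilon>))"
    proof (rule sum_mono)
      fix i assume "i \<in> {..<N}"
      then have "(norm (y (Suc i) - y i))\<^sup>2 \<le> (l i)\<^sup>2"
        using Dl by (intro power_mono) auto
      also have "\<dots> \<le> l i * (l i + \<epsilon> / N)"
        using l0[of i] \<epsilon> by (simp add: power2_eq_square algebra_simps)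
      also have "\<dots> = l i * (L + \<epsilon>) * h i"
        using L0 \<epsilon> by (simp add: h_def)
      finally show "(norm (y (Suc i) - y i))\<^sup>2 / h i \<le> l i * (L + \<epsilon>)"
        using h[of i] by (simp add: divide_le_eq)
    qed
    also have "\<dots> = L * (L + \<epsilon>)" by (simp add: sum_distrib_right[symmetric] suml)
    finally have up: "(\<Sum>i<N. (norm (y (Suc i) - y i))\<^sup>2 / h i) \<le> L * (L + \<epsilon>)" .
    \<comment> \<open>On one piece \<open>x s\<close> stays within \<open>\<epsilon>\<close> of the
      vertex \<open>y i\<close>, so the two integrands differ by at most
      \<open>onorm A * \<epsilon> * norm (xd s)\<close>.\<close>
    have seg: "integral {t i..t (Suc i)} G - A (y i) \<bullet> (y (Suc i) - y i) \<le> onorm A * \<epsilon> * l i"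
      if i: "i < N" for i
    proof -
      have "A (y i) \<bullet> (y (Suc i) - y i) = integral {t i..t (Suc i)} (\<lambda>s. A (y i) \<bullet> xd s)"
        unfolding D[OF i]
        using integral_linear[OF sub[OF int(1) i] bounded_linear_inner_right[of "A (y i)"]]
        by (simp add: o_def)
      moreover have int2: "(\<lambda>s. A (y i) \<bullet> xd s) integrable_on {t i..t (Suc i)}"
        using integrable_linear[OF sub[OF int(1) i] bounded_linear_inner_right[of "A (y i)"]]
        by (simp add: o_def)
      ultimately have "integral {t i..t (Suc i)} G - A (y i) \<bullet> (y (Suc i) - y i)
          = integral {t i..t (Suc i)} (\<lambda>s. G s - A (y i) \<bullet> xd s)"
        using integral_diff[OF sub[OF intG i] int2] by simp
      also have "\<dots> \<le> integral {t i..t (Suc i)} (\<lambda>s. (onorm A * \<epsilon>) * norm (xd s))"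
      proof (rule integral_le)
        show "(\<lambda>s. G s - A (y i) \<bullet> xd s) integrable_on {t i..t (Suc i)}"
          by (intro integrable_diff sub[OF intG i] int2)
        show "(\<lambda>s. (onorm A * \<epsilon>) * norm (xd s)) integrable_on {t i..t (Suc i)}"
          using integrable_on_cmult_left[OF sub[OF int(2) i], of "onorm A * \<epsilon>"] by simp
        fix s assume s: "s \<in> {t i..t (Suc i)}"
        have "dist (x s) (x (t i)) < \<epsilon>"
          using s t[OF i] tstep[of i] by (intro \<delta>(2)) (auto simp: dist_real_def)
        then have xs: "norm (x s - y i) \<le> \<epsilon>" by (simp add: y_def dist_norm)
        have "G s - A (y i) \<bullet> xd s = A (x s - y i) \<bullet> xd s"
          by (simp add: G_def linear_diff[OF skew_linear[OF A]] inner_diff_left)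
        also have "\<dots> \<le> norm (A (x s - y i)) * norm (xd s)" by (rule norm_cauchy_schwarz)
        also have "\<dots> \<le> (onorm A * \<epsilon>) * norm (xd s)"
          using onorm[OF skew_bounded_linear[OF A], of "x s - y i"] xs
            mult_left_mono[OF xs onorm_pos_le[OF skew_bounded_linear[OF A]]]
          by (intro mult_right_mono) auto
        finally show "G s - A (y i) \<bullet> xd s \<le> (onorm A * \<epsilon>) * norm (xd s)" .
      qed
      also have "\<dots> = onorm A * \<epsilon> * l i" by (simp add: l_def)
      finally show ?thesis .
    qed
    have "integral {0..1} G - (\<Sum>i<N. A (y i) \<bullet> (y (Suc i) - y i))
        = (\<Sum>i<N. integral {t i..t (Suc i)} G - A (y i) \<bullet> (y (Suc i) - y i))"
      by (simp add: sum_subtractf tele[OF intG])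
    also have "\<dots> \<le> (\<Sum>i<N. onorm A * \<epsilon> * l i)" using seg by (intro sum_mono) auto
    also have "\<dots> = onorm A * \<epsilon> * L" by (simp add: sum_distrib_left[symmetric] suml)
    finally show ?thesis using poly up by (simp add: power2_eq_square algebra_simps)
  qed
  \<comment> \<open>The summand \<open>1\<close> makes \<open>K\<close> positive, so
    \<open>e / K\<close> is an admissible \<open>\<epsilon>\<close>.\<close>
  define K where "K = L + 2 * onorm A * L + 1"
  have K: "K > 0" "L + 2 * onorm A * L \<le> K"
    using L0 onorm_pos_le[OF skew_bounded_linear[OF A]] by (auto simp: K_def add_nonneg_pos)
  have "cot_energy A 1 (x 1) + 2 * integral {0..1} G \<le> L\<^sup>2 + e" if "e > 0" for e
  proof -
    have "e / K * (L + 2 * onorm A * L) \<le> e / K * K"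
      using K that by (intro mult_left_mono) auto
    then show ?thesis using main[of "e / K"] K(1) that by simp
  qed
  then show ?thesis unfolding G_def L_def by (rule field_le_epsilon)
qed

section \<open>Magnetic geodesics\<close>

lemma has_vector_derivative_skew_fun:
  assumes "\<And>m. ((\<lambda>s. f s m) has_real_derivative f' m) (at s)"
  shows "((\<lambda>s. skew_fun A (f s) v) has_vector_derivative skew_fun A f' v) (at s)"
  unfolding skew_fun_def
  by (intro has_vector_derivative_sum)
    (auto intro!: derivative_eq_intros assms simp: has_real_derivative_iff_has_vector_derivative[symmetric])

text \<open>With \<open>A^2 = - m^2\<close> this is \<open>sinh (2sA) / (2A)\<close>, the even part
  of \<open>(e^(2sA) - 1) / (2A)\<close>.\<close>

definition sin_time :: "real \<Rightarrow> real \<Rightarrow> real" where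
  "sin_time s m = (if m = 0 then s else sin (2 * s * m) / (2 * m))"

text \<open>This is \<open>(sinh (sA) / A)^2\<close>; multiplied by \<open>A\<close> it is the odd
  part of \<open>(e^(2sA) - 1) / (2A)\<close>.\<close>

definition sin_sq_time :: "real \<Rightarrow> real \<Rightarrow> real" where
  "sin_sq_time s m = (if m = 0 then s\<^sup>2 else (sin (s * m) / m)\<^sup>2)"

lemma has_real_derivative_sin_time:
  "((\<lambda>s. sin_time s m) has_real_derivative 1 - 2 * sin_sq_time s m * m\<^sup>2) (at s)"
proof (cases "m = 0")
  case False
  have "((\<lambda>s. sin (2 * s * m) / (2 * m)) has_real_derivative cos (2 * s * m)) (at s)"
    using False by (auto intro!: derivative_eq_intros)
  moreover have "cos (2 * s * m) = 1 - 2 * sin_sq_time s m * m\<^sup>2"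
    using False cos_double_sin[of "s * m"] by (simp add: sin_sq_time_def power_divide mult.assoc)
  ultimately show ?thesis using False by (simp add: sin_time_def[abs_def])
qed (simp add: sin_time_def[abs_def])

lemma has_real_derivative_sin_sq_time:
  "((\<lambda>s. sin_sq_time s m) has_real_derivative 2 * sin_time s m) (at s)"
proof (cases "m = 0")
  case True
  have "((\<lambda>s. s\<^sup>2) has_real_derivative 2 * s) (at s)"
    by (auto intro!: derivative_eq_intros)
  then show ?thesis using True by (simp add: sin_time_def sin_sq_time_def)
next
  case False
  have "((\<lambda>s. (sin (s * m) / m)\<^sup>2) has_real_derivative 2 * (sin (s * m) / m) * cos (s * m)) (at s)"
    using False by (auto intro!: derivative_eq_intros)
  moreover have "2 * (sin (s * m) / m) * cos (s * m) = 2 * sin_time s m"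
    using False sin_double[of "s * m"] by (simp add: sin_time_def mult.assoc)
  ultimately show ?thesis using False by (simp add: sin_sq_time_def[abs_def])
qed

text \<open>These identities give \<open>z 1 = x0\<close> in \<open>magnetic_geodesic\<close>: by
  the first the coefficient of \<open>x0\<close> is \<open>1\<close>, by the second that of
  \<open>A x0\<close> cancels.\<close>

lemma sin_time_cot_time:
  assumes "0 \<le> m" "m < pi"
  shows "sin_time 1 m * cot_time 1 m + sin_sq_time 1 m * m\<^sup>2 = 1"
    and "sin_sq_time 1 m * cot_time 1 m = sin_time 1 m"
proof -
  have s: "sin m > 0" if "m \<noteq> 0" using assms that by (intro sin_gt_zero) auto
  have "(cos m)\<^sup>2 + (sin m)\<^sup>2 = 1" by simp
  then show "sin_time 1 m * cot_time 1 m + sin_sq_time 1 m * m\<^sup>2 = 1"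
    using s by (cases "m = 0")
      (auto simp: sin_time_def sin_sq_time_def cot_time_def cot_def sin_double power2_eq_square)
  show "sin_sq_time 1 m * cot_time 1 m = sin_time 1 m"
    using s by (cases "m = 0")
      (auto simp: sin_time_def sin_sq_time_def cot_time_def cot_def sin_double power2_eq_square)
qed

lemma skew_fun_cong:
  assumes "\<And>e. e \<in> skew_eigenbasis A \<Longrightarrow> f (norm (A e)) = g (norm (A e))"
  shows "skew_fun A f x = skew_fun A g x"
  using assms by (simp add: skew_fun_def)

text \<open>The solution is \<open>z s = (e\<^bsup>2sA\<^esup> - 1) (2A)\<^sup>-\<^sup>1 c\<close> with
  \<open>c = A (sinh A)\<^sup>-\<^sup>1 e\<^bsup>-A\<^esup> x0\<close>, written with even functions of \<open>A\<close>.\<close>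

lemma magnetic_geodesic:
  fixes A :: "'a::euclidean_space \<Rightarrow> 'a"
  assumes A: "skew A" and pi: "onorm A < pi"
  obtains z c where "z 0 = 0" "z 1 = x0" "c \<bullet> x0 = cot_energy A 1 x0"
    "\<And>s. (z has_vector_derivative 2 *\<^sub>R A (z s) + c) (at s)"
proof -
  \<comment> \<open>Here \<open>A (sinh A)^-1 e^(-A) = A coth A - A\<close>, and
    \<open>A coth A\<close> acts as \<open>m cot m\<close>.\<close>
  define c where "c = skew_fun A (cot_time 1) x0 - A x0"
  define z where "z s = skew_fun A (sin_time s) c + skew_fun A (sin_sq_time s) (A c)" for s
  note lin = skew_linear[OF A]
  show ?thesis
  proof (rule that)
    have "sin_time 0 m = 0" "sin_sq_time 0 m = 0" for m
      by (auto simp: sin_time_def sin_sq_time_def)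
    then show "z 0 = 0" by (simp add: z_def skew_fun_def)
    show "c \<bullet> x0 = cot_energy A 1 x0"
      by (simp add: c_def inner_diff_left skew_self[OF A] cot_energy_def)
    have Ac: "A c = skew_fun A (cot_time 1) (A x0) + skew_fun A (\<lambda>m. m\<^sup>2) x0"
      by (simp add: c_def linear_diff[OF lin] skew_commute_skew_fun[OF A] skew_square[OF A])
    have "z 1 = skew_fun A (\<lambda>m. sin_time 1 m * cot_time 1 m) x0 + skew_fun A (\<lambda>m. sin_sq_time 1 m * m\<^sup>2) x0
        + (skew_fun A (\<lambda>m. sin_sq_time 1 m * cot_time 1 m) (A x0) - skew_fun A (sin_time 1) (A x0))"
      unfolding z_def Ac
      by (simp add: c_def linear_diff[OF linear_skew_fun] linear_add[OF linear_skew_fun] skew_fun_comp[OF A])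
    also have "skew_fun A (\<lambda>m. sin_sq_time 1 m * cot_time 1 m) (A x0) = skew_fun A (sin_time 1) (A x0)"
      using skew_eigenvalue_less[OF A pi] sin_time_cot_time by (intro skew_fun_cong) auto
    also have "skew_fun A (\<lambda>m. sin_time 1 m * cot_time 1 m) x0 + skew_fun A (\<lambda>m. sin_sq_time 1 m * m\<^sup>2) x0
        = skew_fun A (\<lambda>m. 1) x0"
      unfolding skew_fun_add
      using skew_eigenvalue_less[OF A pi] sin_time_cot_time by (intro skew_fun_cong) auto
    finally show "z 1 = x0" by (simp add: skew_fun_one[OF A])
    fix s
    have "(z has_vector_derivative skew_fun A (\<lambda>m. 1 - 2 * sin_sq_time s m * m\<^sup>2) c
        + skew_fun A (\<lambda>m. 2 * sin_time s m) (A c)) (at s)"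
      unfolding z_def
      by (intro has_vector_derivative_add has_vector_derivative_skew_fun
          has_real_derivative_sin_time has_real_derivative_sin_sq_time)
    moreover have "skew_fun A (\<lambda>m. 1 - 2 * sin_sq_time s m * m\<^sup>2) c + skew_fun A (\<lambda>m. 2 * sin_time s m) (A c)
        = 2 *\<^sub>R A (z s) + c"
    proof -
      have "A (z s) = skew_fun A (sin_time s) (A c) - skew_fun A (\<lambda>m. sin_sq_time s m * m\<^sup>2) c"
        by (simp add: z_def linear_add[OF lin] skew_commute_skew_fun[OF A] skew_square[OF A]
            linear_neg[OF linear_skew_fun] skew_fun_comp[OF A])
      moreover have "skew_fun A (\<lambda>m. 1 - 2 * sin_sq_time s m * m\<^sup>2) c
          = c - 2 *\<^sub>R skew_fun A (\<lambda>m. sin_sq_time s m * m\<^sup>2) c"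
        by (rule skew_eigenbasis_eqI[OF A])
          (simp add: skew_fun_inner_eigenbasis[OF A] inner_diff_left algebra_simps)
      moreover have "skew_fun A (\<lambda>m. 2 * sin_time s m) (A c) = 2 *\<^sub>R skew_fun A (sin_time s) (A c)"
        by (rule skew_eigenbasis_eqI[OF A]) (simp add: skew_fun_inner_eigenbasis[OF A])
      ultimately show ?thesis by (simp add: scaleR_diff_right)
    qed
    ultimately show "(z has_vector_derivative 2 *\<^sub>R A (z s) + c) (at s)" by simp
  qed
qed

text \<open>The velocity solves \<open>v' = 2 A v\<close>, and
  \<open>A v \<bullet> v = 0\<close>.\<close>

lemma magnetic_geodesic_speed:
  fixes z :: "real \<Rightarrow> 'a::euclidean_space"
  assumes A: "skew A" and z0: "z 0 = 0"
    and z: "\<And>s. (z has_vector_derivative 2 *\<^sub>R A (z s) + c) (at s)"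
  shows "norm (2 *\<^sub>R A (z s) + c) = norm c"
proof -
  define v where "v s = 2 *\<^sub>R A (z s) + c" for s
  have v: "(v has_vector_derivative 2 *\<^sub>R A (v s)) (at s)" for s
    unfolding v_def
    using bounded_linear.has_vector_derivative[OF skew_bounded_linear[OF A] z]
    by (auto intro!: derivative_eq_intros)
  have "((\<lambda>s. v s \<bullet> v s) has_real_derivative 0) (at s)" for s
    using bounded_bilinear.has_vector_derivative[OF bounded_bilinear_inner v v, of s]
    by (simp add: skew_self[OF A] has_real_derivative_iff_has_vector_derivative)
  then have "v s \<bullet> v s = v 0 \<bullet> v 0"
    by (intro DERIV_isconst_all) auto
  moreover have "v 0 = c" by (simp add: v_def z0 linear_0[OF skew_linear[OF A]])
  ultimately show ?thesis by (simp add: v_def norm_eq_sqrt_inner)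
qed



text \<open>Pairing \<open>z' = 2 A z + c\<close> with \<open>z'\<close> and using constant speed
  expresses \<open>c \<bullet> z'\<close> through the magnetic term, while
  \<open>c \<bullet> z'\<close> integrates to \<open>c \<bullet> z 1\<close>. For the curve of
  \<open>magnetic_geodesic\<close> this says that its energy is exactly
  \<open>cot_energy A 1 x0\<close>.\<close>

lemma magnetic_geodesic_energy:
  fixes z :: "real \<Rightarrow> 'a::euclidean_space"
  assumes A: "skew A" and z0: "z 0 = 0" and zd: "\<And>s. zd s = 2 *\<^sub>R A (z s) + c"
    and z: "\<And>s. (z has_vector_derivative zd s) (at s)"
  shows "(norm c)\<^sup>2 = c \<bullet> z 1 + 2 * integral {0..1} (\<lambda>s. A (z s) \<bullet> zd s)"
proof -
  have cz: "continuous_on {0..1} z"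
    using z by (intro continuous_at_imp_continuous_on) (auto intro: has_vector_derivative_continuous)
  have Az: "continuous_on {0..1} (\<lambda>s. A (z s))"
    by (rule linear_continuous_on_compose[OF cz skew_linear[OF A]])
  have eq: "c \<bullet> zd s = (norm c)\<^sup>2 - 2 * (A (z s) \<bullet> zd s)" for s
  proof -
    have "norm (zd s) = norm c"
      unfolding zd by (rule magnetic_geodesic_speed[OF A z0 z[unfolded zd]])
    then have "(norm c)\<^sup>2 = zd s \<bullet> zd s"
      by (simp add: power2_norm_eq_inner[symmetric])
    also have "\<dots> = 2 * (A (z s) \<bullet> zd s) + c \<bullet> zd s"
      by (subst (1) zd) (simp add: inner_add_left)
    finally show ?thesis by simp
  qed
  have "((\<lambda>s. c \<bullet> zd s) has_integral c \<bullet> z 1 - c \<bullet> z 0) {0..1}"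
    using bounded_linear.has_vector_derivative[OF bounded_linear_inner_right z]
    by (intro fundamental_theorem_of_calculus) (auto intro: has_vector_derivative_at_within)
  then have "c \<bullet> z 1 = integral {0..1} (\<lambda>s. c \<bullet> zd s)"
    by (simp add: z0 integral_unique)
  also have "\<dots> = integral {0..1} (\<lambda>s. (norm c)\<^sup>2 - 2 * (A (z s) \<bullet> zd s))"
    by (simp add: eq)
  also have "\<dots> = (norm c)\<^sup>2 - 2 * integral {0..1} (\<lambda>s. A (z s) \<bullet> zd s)"
    unfolding zd
    by (subst integral_diff) (auto intro!: integrable_continuous_interval continuous_intros Az)
  finally show ?thesis by simp
qed

lemma cot_energy_le_C1_length:
  fixes z :: "real \<Rightarrow> 'a::euclidean_space"
  assumes A: "skew A" "onorm A < pi" and z0: "z 0 = 0"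
    and z: "\<And>s. (z has_vector_derivative zd s) (at s)" and zd: "continuous_on {0..1} zd"
  shows "cot_energy A 1 (z 1) + 2 * integral {0..1} (\<lambda>s. A (z s) \<bullet> zd s)
    \<le> (integral {0..1} (\<lambda>s. norm (zd s)))\<^sup>2"
proof (rule cot_energy_le_length_squared[OF A])
  show "zd absolutely_integrable_on {0..1}"
    using zd by (rule absolutely_integrable_continuous_real)
  fix s :: real assume s: "s \<in> {0..1}"
  have "(zd has_integral z s - z 0) {0..s}"
    using s z by (intro fundamental_theorem_of_calculus) (auto intro: has_vector_derivative_at_within)
  then show "z s = integral {0..s} zd" by (simp add: z0 integral_unique)
qed

text \<open>The integral of \<open>(f - L)^2\<close>, where \<open>L\<close> is the mean of
  \<open>f\<close>, is nonnegative.\<close>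

lemma integral_squared_le:
  fixes f :: "real \<Rightarrow> real"
  assumes f: "continuous_on {0..1} f"
  shows "(integral {0..1} f)\<^sup>2 \<le> integral {0..1} (\<lambda>s. (f s)\<^sup>2)"
proof -
  define L where "L = integral {0..1} f"
  have i: "f integrable_on {0..1}" "(\<lambda>s. (f s)\<^sup>2) integrable_on {0..1}"
    using f by (auto intro!: integrable_continuous_interval continuous_intros)
  have "((\<lambda>s. (f s)\<^sup>2 - 2 * L * f s + L\<^sup>2) has_integral
      integral {0..1} (\<lambda>s. (f s)\<^sup>2) - 2 * L * integral {0..1} f + L\<^sup>2) {0..1}"
    using has_integral_const_real[of "L\<^sup>2" 0 1]
    by (intro has_integral_add has_integral_diff has_integral_mult_right integrable_integral i) simp
  moreover have "0 \<le> (f s)\<^sup>2 - 2 * L * f s + L\<^sup>2" for s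
    using zero_le_power2[of "f s - L"] by (simp add: power2_diff algebra_simps)
  ultimately have "0 \<le> integral {0..1} (\<lambda>s. (f s)\<^sup>2) - 2 * L * integral {0..1} f + L\<^sup>2"
    by (rule has_integral_nonneg)
  then show ?thesis by (simp add: L_def power2_eq_square)
qed

section \<open>The derivative of the energy in the skew operator\<close>

lemma skew_add_scaleR:
  fixes A V :: "'a::real_inner \<Rightarrow> 'a"
  assumes "skew A" "skew V"
  shows "skew (\<lambda>x. A x + r *\<^sub>R V x)"
  unfolding skew_def
proof (intro conjI allI)
  show "linear (\<lambda>x. A x + r *\<^sub>R V x)"
    using assms by (intro linear_compose_add linear_compose_scale_right skew_linear)
  show "(A x + r *\<^sub>R V x) \<bullet> y = - (x \<bullet> (A y + r *\<^sub>R V y))" for x y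
    using assms by (simp add: inner_add_left inner_add_right skew_swap[of A] skew_swap[of V])
qed

lemma skew_scaleR:
  fixes A :: "'a::real_inner \<Rightarrow> 'a"
  assumes "skew A"
  shows "skew (\<lambda>x. r *\<^sub>R A x)"
  unfolding skew_def
  using assms by (auto intro: linear_compose_scale_right skew_linear simp: skew_swap[of A])

text \<open>The bound is that of \<open>(1 + \<eta>) B\<close>, whose norm is still below \<open>\<pi>\<close>.\<close>

lemma magnetic_energy_coercive:
  fixes w :: "real \<Rightarrow> 'a::euclidean_space"
  assumes B: "skew B" and \<eta>: "\<eta> > 0" "(1 + \<eta>) * onorm B < pi"
    and w01: "w 0 = 0" "w 1 = 0"
    and w: "\<And>s. (w has_vector_derivative wd s) (at s)" and wd: "continuous_on {0..1} wd"
  shows "\<eta> / (1 + \<eta>) * integral {0..1} (\<lambda>s. (norm (wd s))\<^sup>2)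
    \<le> integral {0..1} (\<lambda>s. (norm (wd s))\<^sup>2) - 2 * integral {0..1} (\<lambda>s. B (w s) \<bullet> wd s)"
proof -
  have B': "skew (\<lambda>x. (1 + \<eta>) *\<^sub>R B x)" by (rule skew_scaleR[OF B])
  have "onorm (\<lambda>x. (1 + \<eta>) *\<^sub>R B x) < pi"
    using \<eta> by (simp add: onorm_scaleR[OF skew_bounded_linear[OF B]])
  from cot_energy_le_C1_length[OF B' this w01(1) w wd]
  \<comment> \<open>Since \<open>w 1 = 0\<close>, the endpoint energy vanishes and the length
    inequality bounds the magnetic term alone.\<close>
  have "2 * ((1 + \<eta>) * integral {0..1} (\<lambda>s. B (w s) \<bullet> wd s)) \<le> (integral {0..1} (\<lambda>s. norm (wd s)))\<^sup>2"
    by (simp add: w01 cot_energy_def)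
  also have "\<dots> \<le> integral {0..1} (\<lambda>s. (norm (wd s))\<^sup>2)"
    using wd by (intro integral_squared_le continuous_intros)
  finally have "2 * integral {0..1} (\<lambda>s. B (w s) \<bullet> wd s) \<le> integral {0..1} (\<lambda>s. (norm (wd s))\<^sup>2) / (1 + \<eta>)"
    using \<eta> by (simp add: field_simps)
  moreover have "\<eta> / (1 + \<eta>) * I = I - I / (1 + \<eta>)" for I
    using \<eta> by (simp add: field_simps)
  ultimately show ?thesis by simp
qed

text \<open>Up to the factor \<open>\<delta>\<close> this is the squared norm of
  \<open>a - (2 r / \<delta>) b\<close>. It absorbs a mixed term of size \<open>r\<close> into the
  coercive one, leaving an error of order \<open>r^2\<close>.\<close>

lemma inner_ge_completed_square:
  fixes a b :: "'a::real_inner"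
  assumes "\<delta> > 0"
  shows "0 \<le> \<delta> * (norm a)\<^sup>2 - 4 * r * (b \<bullet> a) + 4 * r\<^sup>2 / \<delta> * (norm b)\<^sup>2"
proof -
  have "0 \<le> \<delta> * ((a - (2 * r / \<delta>) *\<^sub>R b) \<bullet> (a - (2 * r / \<delta>) *\<^sub>R b))"
    using assms by simp
  also have "\<dots> = \<delta> * (a \<bullet> a) - 4 * r * (b \<bullet> a) + 4 * r\<^sup>2 / \<delta> * (b \<bullet> b)"
    using assms by (simp add: inner_diff_left inner_diff_right inner_commute[of a b] field_simps power2_eq_square)
  finally show ?thesis by (simp add: power2_norm_eq_inner)
qed

text \<open>For the upper bound, the geodesic \<open>z\<close> of \<open>A\<close> is a competitor
  for the perturbed operator. For the lower one, \<open>z\<close> is compared with the geodesic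
  \<open>y\<close> of the perturbed operator: the mixed term in \<open>w = y - z\<close> carries a
  factor \<open>r\<close> and is controlled by coercivity at a cost of order
  \<open>r^2\<close>.\<close>

lemma cot_energy_perturbation:
  fixes A V :: "'a::euclidean_space \<Rightarrow> 'a"
  assumes A: "skew A" and V: "skew V"
    and z0: "z 0 = 0" "z 1 = x0" and zd: "\<And>s. zd s = 2 *\<^sub>R A (z s) + c" and c: "c \<bullet> x0 = cot_energy A 1 x0"
    and z: "\<And>s. (z has_vector_derivative zd s) (at s)"
    and \<eta>: "\<eta> > 0" "(1 + \<eta>) * onorm (\<lambda>x. A x + r *\<^sub>R V x) < pi"
  shows "cot_energy (\<lambda>x. A x + r *\<^sub>R V x) 1 x0
      \<le> cot_energy A 1 x0 - r * (2 * integral {0..1} (\<lambda>s. V (z s) \<bullet> zd s))"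
    and "cot_energy A 1 x0 - r * (2 * integral {0..1} (\<lambda>s. V (z s) \<bullet> zd s))
        - 4 * r\<^sup>2 / (\<eta> / (1 + \<eta>)) * integral {0..1} (\<lambda>s. (norm (V (z s)))\<^sup>2)
      \<le> cot_energy (\<lambda>x. A x + r *\<^sub>R V x) 1 x0"
proof -
  define B where "B x = A x + r *\<^sub>R V x" for x
  define \<delta> where "\<delta> = \<eta> / (1 + \<eta>)"
  have \<delta>: "\<delta> > 0" using \<eta> by (simp add: \<delta>_def)
  have B: "skew B" unfolding B_def by (rule skew_add_scaleR[OF A V])
  have oB: "0 \<le> onorm B" by (rule onorm_pos_le[OF skew_bounded_linear[OF B]])
  have \<eta>B: "(1 + \<eta>) * onorm B < pi" using \<eta>(2) unfolding B_def .
  have piB: "onorm B < pi"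
    using \<eta>B mult_nonneg_nonneg[OF less_imp_le[OF \<eta>(1)] oB] by (simp add: distrib_right)
  obtain y d where y: "y 0 = 0" "y 1 = x0" "d \<bullet> x0 = cot_energy B 1 x0"
    "\<And>s. (y has_vector_derivative 2 *\<^sub>R B (y s) + d) (at s)"
    using magnetic_geodesic[OF B piB, of x0] by blast
  define yd where "yd s = 2 *\<^sub>R B (y s) + d" for s
  have y': "\<And>s. (y has_vector_derivative yd s) (at s)" using y(4) by (simp add: yd_def)
  define w where "w s = y s - z s" for s
  define wd where "wd s = yd s - zd s" for s
  have w: "(w has_vector_derivative wd s) (at s)" for s
    unfolding w_def wd_def by (intro has_vector_derivative_diff y' z)
  have w01: "w 0 = 0" "w 1 = 0" by (auto simp: w_def y z0)
  have cz: "continuous_on {0..1} z" and cy: "continuous_on {0..1} y" and cw: "continuous_on {0..1} w"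
    using z y' w by (auto intro!: continuous_at_imp_continuous_on has_vector_derivative_continuous)
  have lin: "continuous_on {0..1} (\<lambda>s. S (f s))"
    if "continuous_on {0..1} f" "skew S" for f :: "real \<Rightarrow> 'a" and S :: "'a \<Rightarrow> 'a"
    using linear_continuous_on_compose[OF that(1) skew_linear[OF that(2)]] .
  note lins = lin[OF _ A] lin[OF _ B] lin[OF _ V]
  have czd: "continuous_on {0..1} zd"
    unfolding zd[abs_def] by (intro continuous_intros lins cz)
  have cyd: "continuous_on {0..1} yd"
    unfolding yd_def[abs_def] by (intro continuous_intros lins cy)
  have cwd: "continuous_on {0..1} wd"
    unfolding wd_def[abs_def] by (intro continuous_intros czd cyd)
  define I where "I f = integral {0..1} f" for f :: "real \<Rightarrow> real"
  have hI: "(f has_integral I f) {0..1}" if "continuous_on {0..1} f" for f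
    unfolding I_def by (intro integrable_integral integrable_continuous_interval that)
  have speed: "norm (zd s) = norm c" for s
    unfolding zd by (rule magnetic_geodesic_speed[OF A z0(1) z[unfolded zd]])
  have speedB: "norm (yd s) = norm d" for s
    unfolding yd_def by (rule magnetic_geodesic_speed[OF B y(1) y(4)])
  have FA: "cot_energy A 1 x0 = (norm c)\<^sup>2 - 2 * I (\<lambda>s. A (z s) \<bullet> zd s)"
    using magnetic_geodesic_energy[OF A z0(1) zd z] c z0 by (simp add: I_def)
  have FB: "cot_energy B 1 x0 = (norm d)\<^sup>2 - 2 * I (\<lambda>s. B (y s) \<bullet> yd s)"
    using magnetic_geodesic_energy[OF B y(1) yd_def y'] y by (simp add: I_def)
  have split: "I (\<lambda>s. B (z s) \<bullet> zd s) = I (\<lambda>s. A (z s) \<bullet> zd s) + r * I (\<lambda>s. V (z s) \<bullet> zd s)"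
  proof -
    have "((\<lambda>s. A (z s) \<bullet> zd s + r * (V (z s) \<bullet> zd s)) has_integral
        I (\<lambda>s. A (z s) \<bullet> zd s) + r * I (\<lambda>s. V (z s) \<bullet> zd s)) {0..1}"
      by (intro has_integral_add has_integral_mult_right hI continuous_intros lins cz czd)
    then show ?thesis unfolding I_def by (simp add: B_def inner_add_left integral_unique)
  qed
  have "cot_energy B 1 (z 1) + 2 * I (\<lambda>s. B (z s) \<bullet> zd s) \<le> (integral {0..1} (\<lambda>s. norm (zd s)))\<^sup>2"
    unfolding I_def by (rule cot_energy_le_C1_length[OF B piB z0(1) z czd])
  then have "cot_energy B 1 x0 \<le> cot_energy A 1 x0 - r * (2 * I (\<lambda>s. V (z s) \<bullet> zd s))"
    using FA split by (simp add: speed z0)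
  then show "cot_energy (\<lambda>x. A x + r *\<^sub>R V x) 1 x0
      \<le> cot_energy A 1 x0 - r * (2 * integral {0..1} (\<lambda>s. V (z s) \<bullet> zd s))"
    unfolding B_def I_def .
  \<comment> \<open>Skewness of \<open>B\<close> makes the integrand the derivative of
    \<open>B (w s) \<bullet> z s\<close>, which vanishes at both ends.\<close>
  have ibp: "((\<lambda>s. B (w s) \<bullet> zd s - B (z s) \<bullet> wd s) has_integral 0) {0..1}"
  proof -
    have "((\<lambda>s. B (w s) \<bullet> z s) has_vector_derivative (B (w s) \<bullet> zd s - B (z s) \<bullet> wd s)) (at s)" for s
    proof -
      have "((\<lambda>s. B (w s) \<bullet> z s) has_vector_derivative (B (w s) \<bullet> zd s + B (wd s) \<bullet> z s)) (at s)"
        by (intro bounded_bilinear.has_vector_derivative[OF bounded_bilinear_inner]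
            bounded_linear.has_vector_derivative[OF skew_bounded_linear[OF B]] w z)
      moreover have "B (wd s) \<bullet> z s = - (B (z s) \<bullet> wd s)"
        using skew_swap[OF B, of "wd s" "z s"] by (simp add: inner_commute)
      ultimately show ?thesis by simp
    qed
    then have "((\<lambda>s. B (w s) \<bullet> zd s - B (z s) \<bullet> wd s) has_integral B (w 1) \<bullet> z 1 - B (w 0) \<bullet> z 0) {0..1}"
      by (intro fundamental_theorem_of_calculus) (auto intro: has_vector_derivative_at_within)
    then show ?thesis by (simp add: w01 linear_0[OF skew_linear[OF B]])
  qed
  have cwd0: "((\<lambda>s. c \<bullet> wd s) has_integral 0) {0..1}"
  proof -
    have "((\<lambda>s. c \<bullet> wd s) has_integral c \<bullet> w 1 - c \<bullet> w 0) {0..1}"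
      using bounded_linear.has_vector_derivative[OF bounded_linear_inner_right w]
      by (intro fundamental_theorem_of_calculus) (auto intro: has_vector_derivative_at_within)
    then show ?thesis by (simp add: w01)
  qed
  \<comment> \<open>The energy density at \<open>y = z + w\<close>. All mixed terms integrate to
    zero except the one with factor \<open>r\<close>, which arises because \<open>z\<close> solves
    the equation of \<open>A\<close> and not that of \<open>B\<close>.\<close>
  have pt: "(norm (yd s))\<^sup>2 - 2 * (B (y s) \<bullet> yd s) = ((norm (zd s))\<^sup>2 - 2 * (B (z s) \<bullet> zd s))
      + ((norm (wd s))\<^sup>2 - 2 * (B (w s) \<bullet> wd s)) + 2 * (c \<bullet> wd s) - 4 * r * (V (z s) \<bullet> wd s)
      - 2 * (B (w s) \<bullet> zd s - B (z s) \<bullet> wd s)" for s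
  proof -
    have "yd s = zd s + wd s" "y s = z s + w s" by (simp_all add: wd_def w_def)
    moreover have "zd s \<bullet> wd s = 2 * (B (z s) \<bullet> wd s) - 2 * r * (V (z s) \<bullet> wd s) + c \<bullet> wd s"
      by (simp add: zd B_def inner_add_left)
    ultimately show ?thesis
      by (simp add: power2_norm_eq_inner linear_add[OF skew_linear[OF B]] inner_add_left
          inner_add_right inner_commute[of "wd s" "zd s"])
  qed
  let ?W = "I (\<lambda>s. (norm (wd s))\<^sup>2)"
  have "((\<lambda>s. (norm (yd s))\<^sup>2 - 2 * (B (y s) \<bullet> yd s)) has_integral
      (I (\<lambda>s. (norm (zd s))\<^sup>2) - 2 * I (\<lambda>s. B (z s) \<bullet> zd s))
      + (?W - 2 * I (\<lambda>s. B (w s) \<bullet> wd s)) + 2 * 0 - 4 * r * I (\<lambda>s. V (z s) \<bullet> wd s) - 2 * 0) {0..1}"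
    unfolding pt
    by (intro has_integral_add has_integral_diff has_integral_mult_right ibp cwd0 hI
        continuous_intros lins cz czd cw cwd)
  moreover have "((\<lambda>s. (norm (yd s))\<^sup>2 - 2 * (B (y s) \<bullet> yd s)) has_integral
      I (\<lambda>s. (norm (yd s))\<^sup>2) - 2 * I (\<lambda>s. B (y s) \<bullet> yd s)) {0..1}"
    by (intro has_integral_diff has_integral_mult_right hI continuous_intros lins cy cyd)
  ultimately have "I (\<lambda>s. (norm (yd s))\<^sup>2) - 2 * I (\<lambda>s. B (y s) \<bullet> yd s)
     = (I (\<lambda>s. (norm (zd s))\<^sup>2) - 2 * I (\<lambda>s. B (z s) \<bullet> zd s))
      + (?W - 2 * I (\<lambda>s. B (w s) \<bullet> wd s)) + 2 * 0 - 4 * r * I (\<lambda>s. V (z s) \<bullet> wd s) - 2 * 0"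
    by (rule has_integral_unique[symmetric])
  moreover have "I (\<lambda>s. (norm (yd s))\<^sup>2) = (norm d)\<^sup>2" "I (\<lambda>s. (norm (zd s))\<^sup>2) = (norm c)\<^sup>2"
    by (simp_all add: I_def speed speedB)
  ultimately have "cot_energy B 1 x0 = cot_energy A 1 x0 - r * (2 * I (\<lambda>s. V (z s) \<bullet> zd s))
      + (?W - 2 * I (\<lambda>s. B (w s) \<bullet> wd s)) - 4 * r * I (\<lambda>s. V (z s) \<bullet> wd s)"
    using FA FB split by simp
  moreover have "\<delta> * ?W \<le> ?W - 2 * I (\<lambda>s. B (w s) \<bullet> wd s)"
    unfolding \<delta>_def I_def by (rule magnetic_energy_coercive[OF B \<eta>(1) \<eta>B w01 w cwd])
  moreover have "0 \<le> \<delta> * ?W - 4 * r * I (\<lambda>s. V (z s) \<bullet> wd s) + 4 * r\<^sup>2 / \<delta> * I (\<lambda>s. (norm (V (z s)))\<^sup>2)"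
  proof (rule has_integral_nonneg)
    show "((\<lambda>s. \<delta> * (norm (wd s))\<^sup>2 - 4 * r * (V (z s) \<bullet> wd s) + 4 * r\<^sup>2 / \<delta> * (norm (V (z s)))\<^sup>2)
      has_integral \<delta> * ?W - 4 * r * I (\<lambda>s. V (z s) \<bullet> wd s) + 4 * r\<^sup>2 / \<delta> * I (\<lambda>s. (norm (V (z s)))\<^sup>2)) {0..1}"
      by (intro has_integral_add has_integral_diff has_integral_mult_right hI
          continuous_intros lins cz cwd)
  qed (rule inner_ge_completed_square[OF \<delta>])
  ultimately have "cot_energy A 1 x0 - r * (2 * I (\<lambda>s. V (z s) \<bullet> zd s))
        - 4 * r\<^sup>2 / \<delta> * I (\<lambda>s. (norm (V (z s)))\<^sup>2) \<le> cot_energy B 1 x0"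
    by linarith
  then show "cot_energy A 1 x0 - r * (2 * integral {0..1} (\<lambda>s. V (z s) \<bullet> zd s))
        - 4 * r\<^sup>2 / (\<eta> / (1 + \<eta>)) * integral {0..1} (\<lambda>s. (norm (V (z s)))\<^sup>2)
      \<le> cot_energy (\<lambda>x. A x + r *\<^sub>R V x) 1 x0"
    unfolding \<delta>_def I_def B_def .
qed

lemma has_real_derivative_quadratic_remainder:
  fixes f :: "real \<Rightarrow> real"
  assumes "r0 > 0" and bound: "\<And>r. \<bar>r\<bar> < r0 \<Longrightarrow> \<bar>f r - f 0 - r * D\<bar> \<le> C * r\<^sup>2"
  shows "(f has_real_derivative D) (at 0)"
  unfolding has_field_derivative_iff
proof (rule LIM_zero_cancel, rule Lim_null_comparison)
  show "\<forall>\<^sub>F r in at 0. norm ((f r - f 0) / (r - 0) - D) \<le> C * \<bar>r\<bar>"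
    unfolding eventually_at
  proof (intro exI[of _ r0] conjI ballI impI assms(1))
    fix r :: real assume r: "r \<noteq> 0 \<and> dist r 0 < r0"
    have "(f r - f 0) / (r - 0) - D = (f r - f 0 - r * D) / r" using r by (simp add: field_simps)
    then have "norm ((f r - f 0) / (r - 0) - D) = \<bar>f r - f 0 - r * D\<bar> / \<bar>r\<bar>" by simp
    also have "\<dots> \<le> C * r\<^sup>2 / \<bar>r\<bar>" using bound[of r] r by (intro divide_right_mono) auto
    also have "\<dots> = C * \<bar>r\<bar>" using r by (simp add: field_simps power2_eq_square abs_mult_self_eq)
    finally show "norm ((f r - f 0) / (r - 0) - D) \<le> C * \<bar>r\<bar>" .
  qed
  show "((\<lambda>r. C * \<bar>r\<bar>) \<longlongrightarrow> 0) (at 0)"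
    by (auto intro!: tendsto_eq_intros)
qed

text \<open>Envelope principle: the two bounds of \<open>cot_energy_perturbation\<close> differ by a
  term of order \<open>r^2\<close>, so the derivative is computed with the curve held fixed.\<close>

lemma has_real_derivative_cot_energy:
  fixes A V :: "'a::euclidean_space \<Rightarrow> 'a"
  assumes A: "skew A" and pi: "onorm A < pi" and V: "skew V"
    and z0: "z 0 = 0" "z 1 = x0" and zd: "\<And>s. zd s = 2 *\<^sub>R A (z s) + c" and c: "c \<bullet> x0 = cot_energy A 1 x0"
    and z: "\<And>s. (z has_vector_derivative zd s) (at s)"
  shows "((\<lambda>r. cot_energy (\<lambda>x. A x + r *\<^sub>R V x) 1 x0) has_real_derivative
    - (2 * integral {0..1} (\<lambda>s. V (z s) \<bullet> zd s))) (at 0)"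
proof -
  define K where "K = onorm A"
  \<comment> \<open>\<open>M\<close> is midway between \<open>onorm A\<close> and \<open>pi\<close>;
    \<open>r0\<close> keeps the perturbed norm at most \<open>M\<close>, and \<open>\<eta>\<close>
    gives \<open>(1 + \<eta>) * M < pi\<close>. So one constant \<open>C\<close> serves all small
    \<open>r\<close>.\<close>
  define M where "M = (K + pi) / 2"
  define r0 where "r0 = (M - K) / (onorm V + 1)"
  define \<eta> where "\<eta> = (pi - M) / (2 * pi)"
  have bA: "bounded_linear A" and bV: "bounded_linear V" using A V skew_bounded_linear by auto
  have K: "0 \<le> K" "K < M" "M < pi" using pi onorm_pos_le[OF bA] by (auto simp: K_def M_def)
  have V1: "onorm V + 1 > 0" using onorm_pos_le[OF bV] by simp
  have r0: "r0 > 0" unfolding r0_def using K V1 by simp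
  have \<eta>: "\<eta> > 0" unfolding \<eta>_def using K by simp
  have "\<eta> * M \<le> \<eta> * pi" using K \<eta> by (intro mult_left_mono) auto
  also have "\<eta> * pi = (pi - M) / 2" by (simp add: \<eta>_def)
  finally have M\<eta>: "(1 + \<eta>) * M < pi" using K by (simp add: algebra_simps)
  define D where "D = 2 * integral {0..1} (\<lambda>s. V (z s) \<bullet> zd s)"
  define C where "C = 4 / (\<eta> / (1 + \<eta>)) * integral {0..1} (\<lambda>s. (norm (V (z s)))\<^sup>2)"
  let ?f = "\<lambda>r. cot_energy (\<lambda>x. A x + r *\<^sub>R V x) 1 x0"
  show ?thesis
    unfolding D_def[symmetric]
  proof (rule has_real_derivative_quadratic_remainder[OF r0])
    fix r assume r: "\<bar>r\<bar> < r0"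
    have "onorm (\<lambda>x. A x + r *\<^sub>R V x) \<le> onorm A + onorm (\<lambda>x. r *\<^sub>R V x)"
      by (intro onorm_triangle bA bounded_linear_const_scaleR bV)
    also have "\<dots> = K + \<bar>r\<bar> * onorm V" by (simp add: K_def onorm_scaleR[OF bV])
    also have "\<bar>r\<bar> * onorm V \<le> r0 * (onorm V + 1)"
      using r V1 onorm_pos_le[OF bV] by (intro mult_mono) auto
    also have "\<dots> = M - K" using V1 by (simp add: r0_def)
    finally have "onorm (\<lambda>x. A x + r *\<^sub>R V x) \<le> M" by simp
    then have "(1 + \<eta>) * onorm (\<lambda>x. A x + r *\<^sub>R V x) \<le> (1 + \<eta>) * M"
      using \<eta> by (intro mult_left_mono) auto
    then have le: "(1 + \<eta>) * onorm (\<lambda>x. A x + r *\<^sub>R V x) < pi" using M\<eta> by linarith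
    have "?f r \<le> ?f 0 + r * - D" "?f 0 + r * - D - C * r\<^sup>2 \<le> ?f r"
      using cot_energy_perturbation[OF A V z0 zd c z \<eta> le]
      by (simp_all add: D_def C_def field_simps)
    moreover have "0 \<le> C * r\<^sup>2"
      using calculation by linarith
    ultimately show "\<bar>?f r - ?f 0 - r * - D\<bar> \<le> C * r\<^sup>2" by linarith
  qed
qed

section \<open>The phase function as an energy\<close>

lemma skew_matrix:
  fixes R :: "real^'n::finite^'n"
  assumes "transpose R = - R"
  shows "skew ((*v) R)"
  unfolding skew_def
proof (intro conjI allI)
  show "linear ((*v) R)" by simp
  fix x y :: "real^'n"
  have "(R *v x) \<bullet> y = (y v* R) \<bullet> x" by (simp only: dot_lmul_matrix inner_commute[of "R *v x"])
  also have "y v* R = - (R *v y)"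
    by (simp add: transpose_matrix_vector[symmetric] assms vec_eq_iff matrix_vector_mult_def sum_negf)
  finally show "(R *v x) \<bullet> y = - (x \<bullet> (R *v y))" by (simp add: inner_commute)
qed

section \<open>Complexification and functional calculus of the Hermitian matrix\<close>

definition complexify_vec :: "real^'n \<Rightarrow> complex^'n" where
  "complexify_vec x = (\<chi> i. complex_of_real (x $ i))"

definition imag_matrix :: "real^'n^'n \<Rightarrow> complex^'n^'n" where
  "imag_matrix R = (\<chi> a b. \<i> * complex_of_real (R $ a $ b))"

text \<open>Bilinear, without conjugation, as in \<open>phi\<close>. Paired with a real orthonormal
  basis it gives the coordinates of a complex vector.\<close>

definition cpair :: "complex^'n \<Rightarrow> real^'n \<Rightarrow> complex" where
  "cpair v x = (\<Sum>i\<in>UNIV. v $ i * complex_of_real (x $ i))"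

lemma imag_matrix_complexify:
  "imag_matrix R *v complexify_vec x = \<i> *s complexify_vec (R *v x)"
  by (simp add: vec_eq_iff matrix_vector_mult_def imag_matrix_def complexify_vec_def
      sum_distrib_left mult.assoc)

lemma norm_complexify_vec: "norm (complexify_vec x) = norm x"
  by (simp add: norm_vec_def L2_set_def complexify_vec_def)

lemma cpair_scale: "cpair (c *s v) x = c * cpair v x"
  by (simp add: cpair_def sum_distrib_left mult.assoc)

lemma cpair_imag_matrix:
  assumes "transpose R = - R"
  shows "cpair (imag_matrix R *v v) x = - \<i> * cpair v (R *v x)"
proof -
  have R: "R $ a $ b = - (R $ b $ a)" for a b
    using arg_cong[OF assms, of "\<lambda>M. M $ b $ a"] by (simp add: transpose_def)
  have "cpair (imag_matrix R *v v) x
      = (\<Sum>a\<in>UNIV. \<Sum>b\<in>UNIV. \<i> * complex_of_real (R $ a $ b) * v $ b * complex_of_real (x $ a))"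
    by (simp add: cpair_def matrix_vector_mult_def imag_matrix_def sum_distrib_right)
  also have "\<dots> = (\<Sum>b\<in>UNIV. \<Sum>a\<in>UNIV. \<i> * complex_of_real (R $ a $ b) * v $ b * complex_of_real (x $ a))"
    by (rule sum.swap)
  also have "\<dots> = (\<Sum>b\<in>UNIV. \<Sum>a\<in>UNIV. - (\<i> * (v $ b * (complex_of_real (R $ b $ a) * complex_of_real (x $ a)))))"
    by (intro sum.cong refl) (subst R, simp add: mult_ac)
  also have "\<dots> = - \<i> * cpair v (R *v x)"
    by (simp add: cpair_def matrix_vector_mult_def sum_distrib_left sum_negf)
  finally show ?thesis .
qed

lemma eigenbasis_completeness:
  fixes R :: "real^'n::finite^'n"
  assumes "skew ((*v) R)"
  shows "(\<Sum>e\<in>skew_eigenbasis ((*v) R). e $ a * e $ b) = (if a = b then 1 else 0)"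
proof -
  have "(\<Sum>e\<in>skew_eigenbasis ((*v) R). (axis b 1 \<bullet> e) *\<^sub>R e) $ a = (axis b 1 :: real^'n) $ a"
    by (simp only: skew_eigenbasis_expand[OF assms])
  then have "(\<Sum>e\<in>skew_eigenbasis ((*v) R). e $ b * e $ a) = (if a = b then 1 else 0)"
    by (simp add: inner_axis') (simp add: axis_def)
  then show ?thesis by (simp only: mult.commute)
qed

lemma cpair_expand:
  fixes R :: "real^'n::finite^'n"
  assumes "skew ((*v) R)"
  shows "(\<Sum>e\<in>skew_eigenbasis ((*v) R). cpair v e * complex_of_real (e $ a)) = v $ a"
proof -
  have "(\<Sum>e\<in>skew_eigenbasis ((*v) R). cpair v e * complex_of_real (e $ a))
      = (\<Sum>i\<in>UNIV. \<Sum>e\<in>skew_eigenbasis ((*v) R). v $ i * complex_of_real (e $ i) * complex_of_real (e $ a))"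
    unfolding cpair_def sum_distrib_right by (rule sum.swap)
  also have "\<dots> = (\<Sum>i\<in>UNIV. v $ i * complex_of_real (\<Sum>e\<in>skew_eigenbasis ((*v) R). e $ i * e $ a))"
    by (simp add: sum_distrib_left mult.assoc)
  also have "\<dots> = (\<Sum>i\<in>UNIV. v $ i * complex_of_real (if i = a then 1 else 0))"
    by (simp only: eigenbasis_completeness[OF assms])
  also have "\<dots> = v $ a"
    by (simp add: if_distrib cong: if_cong)
  finally show ?thesis .
qed

text \<open>The eigenvectors of \<open>\<i> R\<close> attached to \<open>e\<close> with \<open>R\<^sup>2 e = - m\<^sup>2 e\<close> are \<open>m e \<plusminus> \<i> R e\<close>, with
  eigenvalues \<open>\<plusminus> m\<close>; since \<open>f\<close> takes the same value at both, \<open>e\<close> itself is an eigenvector of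
  \<open>f(\<i> R)\<close>.\<close>

lemma matfun_imag_matrix:
  fixes R :: "real^'n::finite^'n" and g :: "real \<Rightarrow> real"
  assumes R: "transpose R = - R"
    and f: "\<And>m. m \<ge> 0 \<Longrightarrow> f (complex_of_real m) = complex_of_real (g m)"
      "\<And>m. m \<ge> 0 \<Longrightarrow> f (- complex_of_real m) = complex_of_real (g m)"
  shows "matfun f (imag_matrix R) = (\<chi> a b. complex_of_real
    (\<Sum>e\<in>skew_eigenbasis ((*v) R). g (norm (R *v e)) * e $ a * e $ b))"
proof -
  let ?E = "skew_eigenbasis ((*v) R)" and ?M = "imag_matrix R"
  define B :: "complex^'n^'n" where
    "B = (\<chi> a b. complex_of_real (\<Sum>e\<in>?E. g (norm (R *v e)) * e $ a * e $ b))"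
  note sk = skew_matrix[OF R]
  have RR: "R *v (R *v e) = - ((norm (R *v e))\<^sup>2 *\<^sub>R e)" if "e \<in> ?E" for e
    using skew_eigenbasis(3)[OF sk that] .
  \<comment> \<open>Existence for the \<open>THE\<close> in \<open>matfun\<close>. Applying the
    eigenvalue equation twice gives \<open>(c - m) * (c + m) * cpair v e = 0\<close>, so each
    nonzero coordinate forces \<open>c\<close> to be \<open>m\<close> or \<open>- m\<close>, where
    \<open>f c = g m\<close>.\<close>
  have ex: "B *v v = f c *s v" if v: "?M *v v = c *s v" for v c
  proof -
    have gf: "complex_of_real (g (norm (R *v e))) * cpair v e = f c * cpair v e" if e: "e \<in> ?E" for e
    proof -
      define m where "m = norm (R *v e)"
      have "c * (c * cpair v e) = c * cpair (?M *v v) e" by (simp add: v cpair_scale)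
      also have "\<dots> = c * (- \<i> * cpair v (R *v e))"
        by (simp only: cpair_imag_matrix[OF R])
      also have "\<dots> = - \<i> * cpair (?M *v v) (R *v e)"
        by (simp add: v cpair_scale)
      also have "\<dots> = - \<i> * (- \<i> * cpair v (R *v (R *v e)))"
        by (simp only: cpair_imag_matrix[OF R])
      also have "\<dots> = - cpair v (R *v (R *v e))" by simp
      also have "\<dots> = complex_of_real (m\<^sup>2) * cpair v e"
        by (simp add: RR[OF e] cpair_def m_def sum_distrib_left sum_negf mult_ac)
      finally have "(c - complex_of_real m) * (c + complex_of_real m) * cpair v e = 0"
        by (simp add: algebra_simps power2_eq_square)
      then consider "cpair v e = 0" | "c = complex_of_real m" | "c = - complex_of_real m"
        by (auto simp: add_eq_0_iff2)
      then show ?thesis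
        using f[of m] by cases (auto simp: m_def)
    qed
    show ?thesis
      unfolding vec_eq_iff
    proof
      fix a
      have "(B *v v) $ a = (\<Sum>b\<in>UNIV. \<Sum>e\<in>?E. complex_of_real (g (norm (R *v e)) * e $ a * e $ b) * v $ b)"
        by (simp add: B_def matrix_vector_mult_def sum_distrib_right)
      also have "\<dots> = (\<Sum>e\<in>?E. \<Sum>b\<in>UNIV. complex_of_real (g (norm (R *v e)) * e $ a * e $ b) * v $ b)"
        by (rule sum.swap)
      also have "\<dots> = (\<Sum>e\<in>?E. complex_of_real (g (norm (R *v e))) * cpair v e * complex_of_real (e $ a))"
        by (simp add: cpair_def sum_distrib_left sum_distrib_right mult_ac)
      also have "\<dots> = (\<Sum>e\<in>?E. f c * (cpair v e * complex_of_real (e $ a)))"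
        using gf by (intro sum.cong) (auto simp: mult_ac)
      also have "\<dots> = (f c *s v) $ a"
        by (simp add: sum_distrib_left[symmetric] cpair_expand[OF sk])
      finally show "(B *v v) $ a = (f c *s v) $ a" .
    qed
  qed
  \<comment> \<open>Uniqueness: the prescribed action on eigenvectors fixes \<open>C\<close> on
    every complexified basis vector, and these span the space.\<close>
  have uniq: "C = B" if C: "\<forall>v c. ?M *v v = c *s v \<longrightarrow> C *v v = f c *s v" for C
  proof -
    have Ce: "C *v complexify_vec e = complex_of_real (g (norm (R *v e))) *s complexify_vec e"
      if e: "e \<in> ?E" for e
    proof (cases "norm (R *v e) = 0")
      case True
      then have "?M *v complexify_vec e = 0 *s complexify_vec e"
        by (simp add: imag_matrix_complexify) (simp add: complexify_vec_def vec_eq_iff)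
      then have "C *v complexify_vec e = f 0 *s complexify_vec e" using C by blast
      then show ?thesis using f(1)[of 0] True by simp
    next
      case False
      define m where "m = norm (R *v e)"
      have m: "m > 0" using False by (simp add: m_def)
      define E where "E = complexify_vec e"
      define F where "F = \<i> *s complexify_vec (R *v e)"
      have ME: "?M *v E = F" by (simp add: E_def F_def imag_matrix_complexify)
      have MF: "?M *v F = complex_of_real (m\<^sup>2) *s E"
        unfolding F_def vector_scalar_commute imag_matrix_complexify RR[OF e]
        by (simp add: vec_eq_iff complexify_vec_def E_def m_def)
      have "?M *v (complex_of_real m *s E + F) = complex_of_real m *s (complex_of_real m *s E + F)"
        "?M *v (complex_of_real m *s E - F) = (- complex_of_real m) *s (complex_of_real m *s E - F)"
        unfolding matrix_vector_right_distrib matrix_vector_mult_diff_distrib vector_scalar_commute ME MF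
        by (simp_all add: vec_eq_iff algebra_simps power2_eq_square)
      then have "C *v (complex_of_real m *s E + F) = complex_of_real (g m) *s (complex_of_real m *s E + F)"
        "C *v (complex_of_real m *s E - F) = complex_of_real (g m) *s (complex_of_real m *s E - F)"
        using C[rule_format, of "complex_of_real m *s E + F" "complex_of_real m"]
          C[rule_format, of "complex_of_real m *s E - F" "- complex_of_real m"] f[of m] m by auto
      then have CE: "complex_of_real m *s (C *v E) + C *v F = complex_of_real (g m) *s (complex_of_real m *s E + F)"
        "complex_of_real m *s (C *v E) - C *v F = complex_of_real (g m) *s (complex_of_real m *s E - F)"
        unfolding matrix_vector_right_distrib matrix_vector_mult_diff_distrib vector_scalar_commute by auto
      have "complex_of_real m * (C *v E) $ a = complex_of_real m * (complex_of_real (g m) * E $ a)" for a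
      proof -
        \<comment> \<open>Adding the relations for the two eigenvectors eliminates the unknown
          \<open>C *v F\<close>.\<close>
        have cancel: "p = u" if "p + q = u + v" "p - q = u - v" for p q u v :: complex
        proof -
          have "(p + q) + (p - q) = (u + v) + (u - v)" by (simp only: that)
          then show ?thesis by simp
        qed
        show ?thesis
        proof (rule cancel)
          show "complex_of_real m * (C *v E) $ a + (C *v F) $ a
              = complex_of_real m * (complex_of_real (g m) * E $ a) + complex_of_real (g m) * F $ a"
            using arg_cong[OF CE(1), of "\<lambda>v. v $ a"] by (simp add: distrib_left mult_ac)
          show "complex_of_real m * (C *v E) $ a - (C *v F) $ a
              = complex_of_real m * (complex_of_real (g m) * E $ a) - complex_of_real (g m) * F $ a"
            using arg_cong[OF CE(2), of "\<lambda>v. v $ a"] by (simp add: right_diff_distrib mult_ac)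
        qed
      qed
      then have "(C *v E) $ a = (complex_of_real (g m) *s E) $ a" for a using m by simp
      then show ?thesis unfolding E_def m_def by (simp only: vec_eq_iff) blast
    qed
    show "C = B"
      unfolding vec_eq_iff
    proof (intro allI)
      fix a k
      have "complexify_vec (axis k 1) = (\<Sum>e\<in>?E. complex_of_real (e $ k) *s complexify_vec e)"
        using arg_cong[OF eigenbasis_completeness[OF sk], of complex_of_real]
        by (simp add: vec_eq_iff complexify_vec_def axis_def mult.commute if_distrib cong: if_cong)
      then have "C *v complexify_vec (axis k 1) = (\<Sum>e\<in>?E. complex_of_real (e $ k) *s (C *v complexify_vec e))"
        by (simp add: linear_sum[OF matrix_vector_mul_linear] vector_scalar_commute)
      also have "\<dots> = (\<Sum>e\<in>?E. complex_of_real (e $ k) *s (complex_of_real (g (norm (R *v e))) *s complexify_vec e))"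
        using Ce by simp
      finally have "(C *v complexify_vec (axis k 1)) $ a = B $ a $ k"
        by (simp add: B_def complexify_vec_def mult_ac)
      moreover have "(C *v complexify_vec (axis k 1)) $ a = C $ a $ k"
        by (simp add: matrix_vector_mult_def complexify_vec_def axis_def if_distrib cong: if_cong)
      ultimately show "C $ a $ k = B $ a $ k" by simp
    qed
  qed
  show ?thesis
    unfolding matfun_def B_def[symmetric] using ex uniq by (intro the_equality) blast+
qed

lemma zcot_of_real:
  "zcot (complex_of_real m) = complex_of_real (cot_time 1 m)"
  "zcot (- complex_of_real m) = complex_of_real (cot_time 1 m)"
  by (auto simp: zcot_def cot_time_def cot_of_real)

section \<open>The matrices of the group and the phase function\<close>

definition comb_matrix :: "('m::finite \<Rightarrow> real^'n^'n) \<Rightarrow> real^'m \<Rightarrow> real^'n^'n" where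
  "comb_matrix U \<tau> = (\<chi> a b. \<Sum>j\<in>UNIV. \<tau> $ j * U j $ a $ b)"

lemma Ucx_eq_imag_matrix: "Ucx U \<tau> = imag_matrix (comb_matrix U \<tau>)"
  by (simp add: Ucx_def imag_matrix_def comb_matrix_def)

lemma comb_matrix_mult:
  "comb_matrix U \<tau> *v x = (\<Sum>j\<in>UNIV. \<tau> $ j *\<^sub>R (U j *v x))"
proof -
  have "(\<Sum>b\<in>UNIV. (\<Sum>j\<in>UNIV. \<tau> $ j * U j $ a $ b) * x $ b)
      = (\<Sum>j\<in>UNIV. \<tau> $ j * (\<Sum>b\<in>UNIV. U j $ a $ b * x $ b))" for a
    unfolding sum_distrib_left sum_distrib_right by (subst sum.swap) (simp add: mult.assoc)
  then show ?thesis
    by (simp add: vec_eq_iff matrix_vector_mult_def comb_matrix_def)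
qed

lemma comb_matrix_add_axis:
  "comb_matrix U (\<tau> + r *\<^sub>R axis j 1) *v x = comb_matrix U \<tau> *v x + r *\<^sub>R (U j *v x)"
proof -
  have "(\<Sum>k\<in>UNIV. (r * axis j 1 $ k) *\<^sub>R (U k *v x))
      = (\<Sum>k\<in>UNIV. if k = j then r *\<^sub>R (U j *v x) else 0)"
    by (intro sum.cong) (auto simp: axis_def)
  then show ?thesis
    by (simp add: comb_matrix_mult scaleR_add_left sum.distrib)
qed

lemma transpose_comb_matrix:
  assumes "\<And>j. transpose (U j) = - U j"
  shows "transpose (comb_matrix U \<tau>) = - comb_matrix U \<tau>"
proof -
  have eq: "U j $ b $ a = - (U j $ a $ b)" for j a b
    using arg_cong[OF assms[of j], of "\<lambda>M. M $ a $ b"] by (simp add: transpose_def)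
  have "transpose (comb_matrix U \<tau>) $ a $ b = (- comb_matrix U \<tau>) $ a $ b" for a b
    by (simp add: transpose_def comb_matrix_def sum_negf[symmetric] eq[of _ b a])
  then show ?thesis by (simp only: vec_eq_iff) blast
qed

lemma phi_eq_cot_energy:
  assumes "\<And>j. transpose (U j) = - U j"
  shows "phi U (x, t) \<tau> = cot_energy ((*v) (comb_matrix U \<tau>)) 1 x + 4 * (t \<bullet> \<tau>)"
proof -
  define R where "R = comb_matrix U \<tau>"
  let ?E = "skew_eigenbasis ((*v) R)" and ?g = "\<lambda>e. cot_time 1 (norm (R *v e))"
  have R: "transpose R = - R" unfolding R_def by (rule transpose_comb_matrix[OF assms])
  have "Re (\<Sum>a\<in>UNIV. (matfun zcot (Ucx U \<tau>) *v (\<chi> i. complex_of_real (x $ i))) $ a * complex_of_real (x $ a))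
      = (\<Sum>a\<in>UNIV. \<Sum>b\<in>UNIV. \<Sum>e\<in>?E. ?g e * e $ a * e $ b * x $ b * x $ a)"
    unfolding Ucx_eq_imag_matrix R_def[symmetric] matfun_imag_matrix[OF R zcot_of_real]
    by (simp add: matrix_vector_mult_def sum_distrib_right)
  also have "\<dots> = (\<Sum>e\<in>?E. \<Sum>a\<in>UNIV. \<Sum>b\<in>UNIV. ?g e * e $ a * e $ b * x $ b * x $ a)"
    by (subst sum.swap[of _ _ ?E], subst sum.swap) (rule refl)
  also have "\<dots> = cot_energy ((*v) R) 1 x"
    unfolding cot_energy_sum[OF skew_matrix[OF R]]
    by (simp add: inner_vec_def power2_eq_square sum_product sum_distrib_left mult_ac)
  finally show ?thesis by (simp add: phi_def R_def)
qed

text \<open>Real vectors embed isometrically into complex ones, where \<open>Ucx U \<tau>\<close>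
  acts as \<open>\<i>\<close> times the real matrix; so the real norm is at most the complex
  one.\<close>

lemma onorm_comb_matrix_less_pi:
  assumes "\<tau> \<in> Omega_star U"
  shows "onorm ((*v) (comb_matrix U \<tau>)) < pi"
proof -
  let ?R = "comb_matrix U \<tau>"

  have "norm (?R *v x) \<le> onorm ((*v) (Ucx U \<tau>)) * norm x" for x
  proof -
    have "norm (?R *v x) = norm (complexify_vec (?R *v x))" by (simp add: norm_complexify_vec)
    also have "\<dots> = norm (Ucx U \<tau> *v complexify_vec x)"
      unfolding Ucx_eq_imag_matrix imag_matrix_complexify by (simp add: norm_vec_def norm_mult)
    also have "\<dots> \<le> onorm ((*v) (Ucx U \<tau>)) * norm (complexify_vec x)"
      by (rule onorm) simp
    finally show ?thesis by (simp add: norm_complexify_vec)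
  qed
  then have "onorm ((*v) ?R) \<le> onorm ((*v) (Ucx U \<tau>))" by (rule onorm_le)
  then show ?thesis using assms by (simp add: Omega_star_def)
qed

text \<open>The endpoint condition on \<open>t\<close> turns \<open>4 (t \<bullet> \<tau>)\<close>
  into the magnetic term of the energy. Varying \<open>\<tau>\<close> bounds the supremum, and
  varying the curve bounds the distance from below.\<close>

lemma phi_le_length_squared:
  fixes U :: "'m::finite \<Rightarrow> real^'q::finite^'q"
  assumes U: "\<And>j. transpose (U j) = - U j" and \<tau>: "\<tau> \<in> Omega_star U" and l: "l \<in> horiz_lengths U g"
  shows "phi U g \<tau> \<le> l\<^sup>2" and "0 \<le> l"
proof -
  obtain x0 t where g: "g = (x0, t)" by (cases g)
  obtain xd x :: "real \<Rightarrow> real^'q" where xd: "xd absolutely_integrable_on {0..1}"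
    and x: "\<And>s. s \<in> {0..1} \<Longrightarrow> x s = integral {0..s} xd" and x1: "x 1 = x0"
    and t: "(\<chi> j. integral {0..1} (\<lambda>s. (1/2) * ((U j *v x s) \<bullet> xd s))) = t"
    and l: "l = integral {0..1} (\<lambda>s. norm (xd s))"
    using l unfolding horiz_lengths_def g mem_Collect_eq fst_conv snd_conv
    by blast
  let ?R = "comb_matrix U \<tau>"
  have int: "xd integrable_on {0..1}" "(\<lambda>s. norm (xd s)) integrable_on {0..1}"
    using xd by (auto simp: absolutely_integrable_on_def)
  show "0 \<le> l" unfolding l using int by (intro integral_nonneg) auto
  have "continuous_on {0..1} x"
    by (rule continuous_on_eq[OF indefinite_integral_continuous_1[OF int(1)]]) (simp add: x)
  then have intU: "(\<lambda>s. (U j *v x s) \<bullet> xd s) integrable_on {0..1}" for j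
    using absolutely_integrable_linear_inner[OF matrix_vector_mul_linear xd, of x "U j"]
    by (simp add: absolutely_integrable_on_def)
  have "integral {0..1} (\<lambda>s. (U j *v x s) \<bullet> xd s) = 2 * t $ j" for j
    by (simp add: t[symmetric])
  then have "4 * (t \<bullet> \<tau>) = 2 * (\<Sum>j\<in>UNIV. \<tau> $ j * integral {0..1} (\<lambda>s. (U j *v x s) \<bullet> xd s))"
    by (simp add: inner_vec_def[of t \<tau>] sum_distrib_left mult_ac)
  also have "(\<Sum>j\<in>UNIV. \<tau> $ j * integral {0..1} (\<lambda>s. (U j *v x s) \<bullet> xd s))
      = integral {0..1} (\<lambda>s. \<Sum>j\<in>UNIV. \<tau> $ j * ((U j *v x s) \<bullet> xd s))"
    using intU by (subst integral_sum) (auto intro: integrable_on_mult_right)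
  also have "\<dots> = integral {0..1} (\<lambda>s. (?R *v x s) \<bullet> xd s)"
    by (simp add: comb_matrix_mult inner_sum_left)
  finally have "phi U g \<tau> = cot_energy ((*v) ?R) 1 (x 1) + 2 * integral {0..1} (\<lambda>s. (?R *v x s) \<bullet> xd s)"
    by (simp add: g phi_eq_cot_energy[OF U] x1)
  also have "\<dots> \<le> l\<^sup>2"
    unfolding l using \<tau>
    by (intro cot_energy_le_length_squared skew_matrix transpose_comb_matrix U
        onorm_comb_matrix_less_pi xd x)
  finally show "phi U g \<tau> \<le> l\<^sup>2" .
qed

text \<open>The first variation of \<open>phi\<close> at \<open>\<theta>\<close> compares \<open>t\<close> with the vertical displacement of the
  magnetic geodesic of \<open>\<theta>\<close> from \<open>0\<close> to \<open>x0\<close>, so criticality says that its horizontal lift ends at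
  \<open>(x0, t)\<close>.\<close>

lemma crit_geodesic:
  fixes U :: "'m::finite \<Rightarrow> real^'q::finite^'q"
  assumes U: "\<And>j. transpose (U j) = - U j" and \<theta>: "\<theta> \<in> Omega_star U"
    and crit: "\<And>j. partial (phi U g) j \<theta> = 0"
  obtains l where "l \<in> horiz_lengths U g" "phi U g \<theta> = l\<^sup>2"
proof -
  obtain x0 t where g: "g = (x0, t)" by (cases g)
  define A where "A = (*v) (comb_matrix U \<theta>)"
  have A: "skew A" unfolding A_def by (intro skew_matrix transpose_comb_matrix U)
  have pi: "onorm A < pi" unfolding A_def by (rule onorm_comb_matrix_less_pi[OF \<theta>])
  obtain z c where z0: "z 0 = 0" and z1: "z 1 = x0" and c: "c \<bullet> x0 = cot_energy A 1 x0"
    and z: "\<And>s. (z has_vector_derivative 2 *\<^sub>R A (z s) + c) (at s)"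
    using magnetic_geodesic[OF A pi, of x0] by blast
  define zd where "zd s = 2 *\<^sub>R A (z s) + c" for s
  have zd: "\<And>s. (z has_vector_derivative zd s) (at s)" using z by (simp add: zd_def)
  have "continuous_on {0..1} z"
    using z by (auto intro!: continuous_at_imp_continuous_on has_vector_derivative_continuous)
  then have cA: "continuous_on {0..1} (\<lambda>s. A (z s))"
    by (rule linear_continuous_on_compose[OF _ skew_linear[OF A]])
  have czd: "continuous_on {0..1} zd"
    unfolding zd_def[abs_def] by (intro continuous_intros cA)
  \<comment> \<open>A step \<open>r\<close> along the \<open>j\<close>-th axis adds \<open>r\<close>
    times \<open>U j\<close> to \<open>A\<close>, so the envelope formula applies with
    \<open>V\<close> equal to \<open>U j\<close>.\<close>
  have t: "t $ j = (1/2) * integral {0..1} (\<lambda>s. (U j *v z s) \<bullet> zd s)" for j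
  proof -
    let ?D = "- (2 * integral {0..1} (\<lambda>s. (U j *v z s) \<bullet> zd s))"
    have "((\<lambda>r. cot_energy (\<lambda>x. A x + r *\<^sub>R (U j *v x)) 1 x0) has_real_derivative ?D) (at 0)"
      by (rule has_real_derivative_cot_energy[OF A pi skew_matrix[OF U] z0 z1 zd_def c zd])
    then have "((\<lambda>r. cot_energy (\<lambda>x. A x + r *\<^sub>R (U j *v x)) 1 x0 + 4 * (t \<bullet> \<theta> + r * t $ j))
        has_real_derivative ?D + 4 * t $ j) (at 0)"
      by (auto intro!: derivative_eq_intros)
    moreover have "phi U g (\<theta> + r *\<^sub>R axis j 1)
        = cot_energy (\<lambda>x. A x + r *\<^sub>R (U j *v x)) 1 x0 + 4 * (t \<bullet> \<theta> + r * t $ j)" for r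
      by (simp add: g phi_eq_cot_energy[OF U] comb_matrix_add_axis[abs_def] A_def inner_add_right inner_axis)
    ultimately have "partial (phi U g) j \<theta> = ?D + 4 * t $ j"
      unfolding partial_def by (simp add: DERIV_imp_deriv)
    then show ?thesis using crit[of j] by simp
  qed
  have speed: "norm (zd s) = norm c" for s
    unfolding zd_def by (rule magnetic_geodesic_speed[OF A z0 z])
  have "norm c \<in> horiz_lengths U g"
    unfolding horiz_lengths_def
  proof (rule CollectI, intro exI conjI ballI)
    show "norm c = integral {0..1} (\<lambda>s. norm (zd s))" by (simp add: speed)
    show "zd absolutely_integrable_on {0..1}"
      using czd by (rule absolutely_integrable_continuous_real)
    show "z 1 = fst g" by (simp add: z1 g)
    show "(\<chi> j. integral {0..1} (\<lambda>s. (1/2) * ((U j *v z s) \<bullet> zd s))) = snd g"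
      by (simp add: g vec_eq_iff t)
    fix s :: real assume s: "s \<in> {0..1}"
    have "(zd has_integral z s - z 0) {0..s}"
      using s zd by (intro fundamental_theorem_of_calculus) (auto intro: has_vector_derivative_at_within)
    then show "z s = integral {0..s} zd" by (simp add: z0 integral_unique)
  qed
  moreover have "phi U g \<theta> = (norm c)\<^sup>2"
  proof (rule antisym)
    show "phi U g \<theta> \<le> (norm c)\<^sup>2"
      by (rule phi_le_length_squared(1)[OF U \<theta> calculation])
    have "integral {0..1} (\<lambda>s. A (z s) \<bullet> zd s)
        = (\<Sum>j\<in>UNIV. \<theta> $ j * integral {0..1} (\<lambda>s. (U j *v z s) \<bullet> zd s))"
    proof -
      have "((\<lambda>s. \<Sum>j\<in>UNIV. \<theta> $ j * ((U j *v z s) \<bullet> zd s)) has_integral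
          (\<Sum>j\<in>UNIV. \<theta> $ j * integral {0..1} (\<lambda>s. (U j *v z s) \<bullet> zd s))) {0..1}"
        using czd \<open>continuous_on {0..1} z\<close>
        by (intro has_integral_sum has_integral_mult_right integrable_integral
            integrable_continuous_interval continuous_intros
            linear_continuous_on_compose[OF _ matrix_vector_mul_linear]) auto
      then show ?thesis by (simp add: A_def comb_matrix_mult inner_sum_left integral_unique)
    qed
    \<comment> \<open>With \<open>t\<close> identified as the endpoint of the lift, the magnetic
      term becomes \<open>4 (t \<bullet> \<theta>)\<close>, and the energy identity of the geodesic
      evaluates \<open>phi U g \<theta>\<close>.\<close>
    then have "2 * integral {0..1} (\<lambda>s. A (z s) \<bullet> zd s) = 4 * (t \<bullet> \<theta>)"
      by (simp add: inner_vec_def[of t \<theta>] t sum_distrib_left mult_ac)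
    then show "(norm c)\<^sup>2 \<le> phi U g \<theta>"
      using magnetic_geodesic_energy[OF A z0 zd_def zd] c z1
      by (simp add: g phi_eq_cot_energy[OF U] A_def)
  qed
  ultimately show ?thesis by (rule that)
qed

theorem theorem2p3:
  fixes U :: "'m::finite \<Rightarrow> real^'q::finite^'q"
    and g0 :: "(real^'q) \<times> (real^'m)" and \<theta>0 :: "real^'m"
  assumes "skew_family U"
    and "g0 \<in> Mset U"
    and "nondeg_crit U g0 \<theta>0"
  shows "(cc_dist U g0)^2 = phi U g0 \<theta>0
       \<and> bdd_above (phi U g0 ` Omega_star U)
       \<and> phi U g0 \<theta>0 = (SUP \<tau>\<in>Omega_star U. phi U g0 \<tau>)"
proof -
  have U: "\<And>j. transpose (U j) = - U j" using assms(1) by (simp add: skew_family_def)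
  have \<theta>: "\<theta>0 \<in> Omega_star U" and crit: "\<And>j. partial (phi U g0) j \<theta>0 = 0"
    using assms(3) by (auto simp: nondeg_crit_def)
  obtain l where l: "l \<in> horiz_lengths U g0" and phil: "phi U g0 \<theta>0 = l\<^sup>2"
    using crit_geodesic[OF U \<theta> crit] by blast
  \<comment> \<open>The curve found from \<open>\<theta>0\<close> bounds the phase at every other
    parameter as well.\<close>
  have max: "phi U g0 \<tau> \<le> phi U g0 \<theta>0" if "\<tau> \<in> Omega_star U" for \<tau>
    unfolding phil by (rule phi_le_length_squared(1)[OF U that l])
  \<comment> \<open>At \<open>\<theta>0\<close> the phase equals \<open>l\<close> squared and is at
    most the square of any competing length, so the infimum is attained.\<close>
  have "l \<le> l'" if "l' \<in> horiz_lengths U g0" for l'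
    using phi_le_length_squared[OF U \<theta> that] phil by (auto intro: power2_le_imp_le)
  then have "cc_dist U g0 = l"
    unfolding cc_dist_def using l by (intro cInf_eq_minimum) auto
  moreover have "bdd_above (phi U g0 ` Omega_star U)"
    using max by (intro bdd_aboveI2)
  moreover have "(SUP \<tau>\<in>Omega_star U. phi U g0 \<tau>) = phi U g0 \<theta>0"
    using max \<theta> by (intro cSup_eq_maximum) auto
  ultimately show ?thesis using phil by simp
qed

end
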